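(* Let $P\in\mathbb{C}[x,y]$ have no zeros in $\mathbb{H}^2$, satisfy $P(0,0)=0$, and have no common factors with $\bar P$, and let $L_1,\dots,L_M$, $q_1,\dots,q_M$ be the data of $[P]$ described in the context. Let $K=\max\{2L_1,\dots,2L_M\}$. Then $$\mathcal{I}^{K+1}_P\subset\prod_{j=1}^M\bigl(y+q_j(x),\,x^{2L_j}\bigr),$$ and consequently $$\prod_{j=1}^M\bigl(y+q_j(x),x^{2L_j}\bigr)=\mathcal{I}^{K+1}_P=\mathcal{I}^{\infty}_P,$$ where the left side is the product of the ideals $(y+q_j(x),x^{2L_j})$ in $\mathbb{C}\{x,y\}$.
   Context: $\mathbb{H}=\{z\in\mathbb{C}:\operatorname{Im} z>0\}$. $\bar P(x,y)=\overline{P(\bar x,\bar y)}$. $\mathbb{C}\{x,y\}$ is the ring of convergent power series at $(0,0)$. $f\in L^{\mathfrak{p}}_{loc}$ means $f\in L^{\mathfrak{p}}(U)$ for some neighborhood $U$ of $(0,0)$ in $\mathbb{R}^2$; $\mathcal{I}^{\mathfrak{p}}_P=\{Q\in\mathbb{C}\{x,y\}:Q/P\in L^{\mathfrak{p}}_{loc}\}$. By a theorem of Bickel–Knese–Pascoe–Sola, for such $P$ vanishing to order $M$ at $(0,0)$ there exist $L_1,\dots,L_M\in\mathbb{N}$ and $q_1,\dots,q_M\in\mathbb{R}[x]$ with $q_j(0)=0$, $q_j'(0)>0$, $\deg q_j<2L_j$, such that $[P]=\prod_{j=1}^M(y+q_j(x)+ix^{2L_j})$ satisfies: $P/[P]$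 and $[P]/P$ are bounded on a punctured neighborhood of $(0,0)$ in $\mathbb{R}^2$. *)

theory Defs
  imports "HOL-Analysis.Analysis" "HOL-Computational_Algebra.Polynomial"
begin

text \<open>Bivariate polynomials in C[x,y] are represented as complex poly poly:
  the outer variable is y, the coefficients are polynomials in x.\<close>

definition eval2 :: "complex poly poly \<Rightarrow> complex \<Rightarrow> complex \<Rightarrow> complex" where
  "eval2 P x y = poly (map_poly (\<lambda>a. poly a x) P) y"

text \<open>The polynomial P-bar(x,y) = conj (P (conj x, conj y)): conjugate all coefficients.\<close>
definition conj2 :: "complex poly poly \<Rightarrow> complex poly poly" where
  "conj2 P = map_poly (map_poly cnj) P"

definition vanishing_order :: "complex poly poly \<Rightarrow> nat" where
  "vanishing_order P = (LEAST n. \<exists>i j. coeff (coeff P j) i \<noteq> 0 \<and> n = i + j)"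

text \<open>Elements of C{x,y}: coefficient arrays c i j (coefficient of x^i y^j) of a
  power series converging on some polydisc around the origin.\<close>
definition conv_ps :: "(nat \<Rightarrow> nat \<Rightarrow> complex) \<Rightarrow> bool" where
  "conv_ps c \<longleftrightarrow> (\<exists>r>0. (\<lambda>(i,j). norm (c i j) * r ^ (i + j)) summable_on UNIV)"

definition ps_eval :: "(nat \<Rightarrow> nat \<Rightarrow> complex) \<Rightarrow> complex \<Rightarrow> complex \<Rightarrow> complex" where
  "ps_eval c x y = (\<Sum>\<^sub>\<infinity>(i,j)\<in>UNIV. c i j * x ^ i * y ^ j)"

definition Lp_loc :: "real \<Rightarrow> (real \<times> real \<Rightarrow> complex) \<Rightarrow> bool" where
  "Lp_loc p f \<longleftrightarrow> (\<exists>U. open U \<and> (0,0) \<in> U \<and>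
      set_borel_measurable lborel U f \<and> set_integrable lborel U (\<lambda>z. norm (f z) powr p))"

definition Linf_loc :: "(real \<times> real \<Rightarrow> complex) \<Rightarrow> bool" where
  "Linf_loc f \<longleftrightarrow> (\<exists>U C. open U \<and> (0,0) \<in> U \<and>
      set_borel_measurable lborel U f \<and> (AE z in lborel. z \<in> U \<longrightarrow> norm (f z) \<le> C))"

definition quot_real :: "(nat \<Rightarrow> nat \<Rightarrow> complex) \<Rightarrow> complex poly poly \<Rightarrow> real \<times> real \<Rightarrow> complex" where
  "quot_real Q P = (\<lambda>(x,y). ps_eval Q (of_real x) (of_real y) / eval2 P (of_real x) (of_real y))"

definition I_p :: "real \<Rightarrow> complex poly poly \<Rightarrow> (nat \<Rightarrow> nat \<Rightarrow> complex) set" where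
  "I_p p P = {Q. conv_ps Q \<and> Lp_loc p (quot_real Q P)}"

definition I_inf :: "complex poly poly \<Rightarrow> (nat \<Rightarrow> nat \<Rightarrow> complex) set" where
  "I_inf P = {Q. conv_ps Q \<and> Linf_loc (quot_real Q P)}"

text \<open>The product of the ideals (a_j, b_j), j < M, in C{x,y} is generated by the
  products prod_{j in S} a_j * prod_{j notin S} b_j, S \<subseteq> {..<M}.
  Membership: Q equals a C{x,y}-combination of these generators near the origin.\<close>
definition prod_ideal ::
  "nat \<Rightarrow> (nat \<Rightarrow> complex \<Rightarrow> complex \<Rightarrow> complex) \<Rightarrow> (nat \<Rightarrow> complex \<Rightarrow> complex \<Rightarrow> complex)
     \<Rightarrow> (nat \<Rightarrow> nat \<Rightarrow> complex) set" where
  "prod_ideal M a b = {Q. conv_ps Q \<and> (\<exists>h. (\<forall>S. conv_ps (h S)) \<and> (\<exists>e>0. \<forall>x y. norm x < e \<and> norm y < e \<longrightarrow>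
      ps_eval Q x y = (\<Sum>S\<in>Pow {..<M}. ps_eval (h S) x y *
          (\<Prod>j<M. if j \<in> S then a j x y else b j x y))))}"

end

theory Submission
  imports Defs "HOL-Complex_Analysis.Complex_Analysis" "HOL-Library.Landau_Symbols"
begin

text \<open>
  Put \<open>m\<^sub>j = 2 L\<^sub>j\<close>. Substituting \<open>y = s x\<^bsup>m\<^sub>j\<^esup> - q\<^sub>j(x)\<close> in the integral of \<open>|Q/P|\<^bsup>K+1\<^esup>\<close>
  produces the Jacobian \<open>x\<^bsup>m\<^sub>j\<^esup>\<close>; for almost every \<open>s\<close> the integral over \<open>x\<close> is finite, and
  since \<open>m\<^sub>j - (K+1) \<le> -1\<close> the order in \<open>x\<close> of \<open>Q\<close> along the curve cannot be smaller than that
  of \<open>[P]\<close>.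

  These bounds imply membership in the product ideal, by induction on the number of factors.
  Let \<open>m\<^sub>j\<close> be the largest exponent. As the bounds on \<open>Q(x, s x\<^bsup>m\<^sub>j\<^esup> - q\<^sub>j(x))\<close> hold for infinitely
  many \<open>s\<close>, they hold for \<open>s = 0\<close>, so \<open>Q(x, -q\<^sub>j(x))\<close> is divisible by the restriction of
  \<open>x\<^bsup>m\<^sub>j\<^esup> G\<close>, where \<open>G\<close> is a generator of the remaining product whose restriction to
  \<open>y = -q\<^sub>j(x)\<close> has the least order. Hence \<open>Q = \<alpha>(x) x\<^bsup>m\<^sub>j\<^esup> G + (y + q\<^sub>j) C\<close>, and \<open>C\<close> inherits
  the bounds for the remaining factors: by maximality of \<open>m\<^sub>j\<close>, on each of the other curves
  \<open>y + q\<^sub>j\<close> has, for all but one \<open>s\<close>, the order of \<open>y + q\<^sub>j + \<i> x\<^bsup>m\<^sub>j\<^esup>\<close>.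
\<close>

section \<open>Convergent power series and Osgood's lemma\<close>

text \<open>Integrability yields bounds for almost every s only, so it says nothing directly about s
  = 0, the curve on which the division takes place. The gap is closed algebraically, and for that
  infinitely many s are enough. The induction therefore carries infinite sets of s; such a set also
  survives the loss of one exceptional s on each remaining curve whenever a linear factor is divided
  out.

  The argument shears coordinates, restricts to curves and divides by units, which is awkward on
  coefficient arrays. It is carried out on functions near the origin, and Osgood's lemma leads back
  to convergent series.

  The opposite inclusions are elementary. For real x and y, each factor of [P] has y + q_j(x) as
  real part and x^(m_j) as imaginary part, so every generator of the product ideal is bounded by
  [P]. A bounded quotient is integrable to any nonnegative power on a neighbourhood of finite
  measure.\<close>

text \<open>Holomorphy along every holomorphic curve is a form of joint holomorphy that passes to
  compositions such as \<open>f(x, y + g(x))\<close> without further work.\<close>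
definition hol2 :: "real \<Rightarrow> (complex \<times> complex \<Rightarrow> complex) \<Rightarrow> bool" where
  "hol2 r f \<longleftrightarrow> r > 0 \<and> (\<exists>B. \<forall>x y. norm x < r \<longrightarrow> norm y < r \<longrightarrow> norm (f (x, y)) \<le> B) \<and>
     (\<forall>A u v. open A \<longrightarrow> u holomorphic_on A \<longrightarrow> v holomorphic_on A \<longrightarrow>
        (\<forall>z\<in>A. norm (u z) < r \<and> norm (v z) < r) \<longrightarrow> (\<lambda>z. f (u z, v z)) holomorphic_on A)"

definition germ2 :: "(complex \<times> complex \<Rightarrow> complex) \<Rightarrow> bool" where
  "germ2 f \<longleftrightarrow> (\<exists>r. hol2 r f)"

lemma ps_term_bound:
  fixes x y :: complex
  assumes "norm x \<le> r" "norm y \<le> r"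
  shows "norm (c i j * x ^ i * y ^ j) \<le> norm (c i j) * r ^ (i + j)"
proof -
  have "norm (c i j * x ^ i * y ^ j) = norm (c i j) * (norm x ^ i * norm y ^ j)"
    by (simp add: norm_mult norm_power)
  also have "\<dots> \<le> norm (c i j) * (r ^ i * r ^ j)"
    using assms order_trans[OF norm_ge_zero assms(1)]
    by (intro mult_left_mono mult_mono power_mono) auto
  finally show ?thesis by (simp add: power_add)
qed

lemma ps_eval_has_sum:
  assumes sm: "(\<lambda>(i,j). norm (c i j) * r ^ (i + j)) summable_on UNIV"
    and "norm x \<le> r" "norm y \<le> r"
  shows "((\<lambda>(i,j). c i j * x ^ i * y ^ j) has_sum ps_eval c x y) UNIV"
  unfolding ps_eval_def
proof (rule has_sum_infsum, rule abs_summable_summable, rule Infinite_Sum.abs_summable_on_comparison_test'[OF sm])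
  fix p show "norm (case p of (i, j) \<Rightarrow> c i j * x ^ i * y ^ j)
      \<le> (case p of (i, j) \<Rightarrow> norm (c i j) * r ^ (i + j))"
    using ps_term_bound[OF assms(2,3), of c] by (cases p) auto
qed

lemma ps_eval_uniform_limit:
  assumes sm: "(\<lambda>(i,j). norm (c i j) * r ^ (i + j)) summable_on UNIV"
  shows "uniform_limit (cball 0 r \<times> cball 0 r)
     (\<lambda>X z. \<Sum>(i,j)\<in>X. c i j * fst z ^ i * snd z ^ j)
     (\<lambda>z. ps_eval c (fst z) (snd z)) (finite_subsets_at_top UNIV)"
proof -
  have "uniform_limit (cball 0 r \<times> cball 0 r)
     (\<lambda>X z. \<Sum>p\<in>X. c (fst p) (snd p) * fst z ^ fst p * snd z ^ snd p)
     (\<lambda>z. \<Sum>\<^sub>\<infinity>p\<in>UNIV. c (fst p) (snd p) * fst z ^ fst p * snd z ^ snd p) (finite_subsets_at_top UNIV)"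
  proof (rule Weierstrass_m_test_general[OF _ sm])
    fix p :: "nat \<times> nat" and z :: "complex \<times> complex" assume "z \<in> cball 0 r \<times> cball 0 r"
    then show "norm (c (fst p) (snd p) * fst z ^ fst p * snd z ^ snd p)
       \<le> (case p of (i, j) \<Rightarrow> norm (c i j) * r ^ (i + j))"
      using ps_term_bound[of "fst z" r "snd z" c "fst p" "snd p"] by (cases p) auto
  qed
  then show ?thesis by (simp add: ps_eval_def case_prod_unfold)
qed

lemma continuous_on_ps_eval:
  assumes "conv_ps c"
  shows "\<exists>r>0. continuous_on (cball 0 r \<times> cball 0 r) (\<lambda>z. ps_eval c (fst z) (snd z))"
proof -
  obtain r where r: "r > 0" "(\<lambda>(i,j). norm (c i j) * r ^ (i + j)) summable_on UNIV"
    using assms unfolding conv_ps_def by blast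
  have "continuous_on (cball 0 r \<times> cball 0 r) (\<lambda>z. ps_eval c (fst z) (snd z))"
    by (rule uniform_limit_theorem[OF _ ps_eval_uniform_limit[OF r(2)]])
       (simp_all add: always_eventually case_prod_unfold continuous_intros)
  with r show ?thesis by blast
qed

text \<open>Along a holomorphic curve the finite partial sums are holomorphic in one variable and
  converge uniformly on small closed discs, so the one-variable limit theorem suffices.\<close>

lemma ps_eval_germ2:
  assumes "conv_ps c"
  shows "germ2 (\<lambda>z. ps_eval c (fst z) (snd z))"
proof -
  obtain r where r: "r > 0" and sm: "(\<lambda>(i,j). norm (c i j) * r ^ (i + j)) summable_on UNIV"
    using assms unfolding conv_ps_def by blast
  have "norm (ps_eval c x y) \<le> (\<Sum>\<^sub>\<infinity>(i,j)\<in>UNIV. norm (c i j) * r ^ (i + j))"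
    if "norm x < r" "norm y < r" for x y
  proof (rule norm_infsum_le[OF ps_eval_has_sum[OF sm] has_sum_infsum[OF sm]])
    show le: "norm x \<le> r" "norm y \<le> r" using that by auto
    fix p show "norm (case p of (i, j) \<Rightarrow> c i j * x ^ i * y ^ j)
      \<le> (case p of (i, j) \<Rightarrow> norm (c i j) * r ^ (i + j))"
      using ps_term_bound[OF le, of c] by (cases p) auto
  qed
  moreover have "(\<lambda>z. ps_eval c (u z) (v z)) holomorphic_on A"
    if A: "open A" and u: "u holomorphic_on A" and v: "v holomorphic_on A"
      and uv: "\<forall>z\<in>A. norm (u z) < r \<and> norm (v z) < r" for A u v
  proof -
    have "(\<lambda>z. ps_eval c (u z) (v z)) field_differentiable at w" if w: "w \<in> A" for w
    proof -
      obtain d where d: "d > 0" "cball w d \<subseteq> A" using A w open_contains_cball by blast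
      have hol: "(\<lambda>z. \<Sum>(i,j)\<in>X. c i j * u z ^ i * v z ^ j) holomorphic_on A" for X
        unfolding case_prod_unfold by (intro holomorphic_intros u v)
      have "uniform_limit (cball w d) (\<lambda>X z. \<Sum>(i,j)\<in>X. c i j * u z ^ i * v z ^ j)
         (\<lambda>z. ps_eval c (u z) (v z)) (finite_subsets_at_top UNIV)"
        using uniform_limit_compose'[OF ps_eval_uniform_limit[OF sm], of "\<lambda>z. (u z, v z)" "cball w d"]
          d(2) uv by (auto simp: Pi_def less_imp_le subset_iff)
      then have "(\<lambda>z. ps_eval c (u z) (v z)) holomorphic_on ball w d"
      proof (rule holomorphic_uniform_limit[rotated])
        have "ball w d \<subseteq> A" using d(2) ball_subset_cball by blast
        then show "\<forall>\<^sub>F X in finite_subsets_at_top UNIV.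
           continuous_on (cball w d) (\<lambda>z. \<Sum>(i,j)\<in>X. c i j * u z ^ i * v z ^ j) \<and>
           (\<lambda>z. \<Sum>(i,j)\<in>X. c i j * u z ^ i * v z ^ j) holomorphic_on ball w d"
          using holomorphic_on_imp_continuous_on[OF holomorphic_on_subset[OF hol d(2)]]
            holomorphic_on_subset[OF hol] by (intro always_eventually) blast
      qed auto
      then show ?thesis using d(1) by (auto intro: holomorphic_on_imp_differentiable_at)
    qed
    then show ?thesis
      by (auto simp: holomorphic_on_def intro: field_differentiable_at_within)
  qed
  ultimately have "hol2 r (\<lambda>z. ps_eval c (fst z) (snd z))"
    unfolding hol2_def using r by auto
  then show ?thesis unfolding germ2_def by blast
qed

section \<open>Cauchy estimates for Taylor coefficients\<close>

lemma taylor_coeff_bound: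
  assumes hol: "g holomorphic_on ball 0 r" and bd: "\<And>z. norm z < r \<Longrightarrow> norm (g z) \<le> B"
    and \<rho>: "0 < \<rho>" "\<rho> < r"
  shows "norm ((deriv ^^ n) g 0 / fact n) \<le> B / \<rho> ^ n"
proof -
  have "norm ((deriv ^^ n) g 0) \<le> fact n * B / \<rho> ^ n"
  proof (rule Cauchy_inequality)
    show "g holomorphic_on ball 0 \<rho>" by (rule holomorphic_on_subset[OF hol]) (use \<rho> in auto)
    show "continuous_on (cball 0 \<rho>) g"
      by (rule holomorphic_on_imp_continuous_on, rule holomorphic_on_subset[OF hol]) (use \<rho> in auto)
  qed (use \<rho> bd in auto)
  then show ?thesis by (simp add: norm_divide field_simps)
qed

text \<open>The tail after degree j is dominated by a geometric series, whose ratio is at most 1/2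
  because \<open>norm y \<le> \<rho> / 2\<close>. The factor \<open>norm y\<close> makes the
  quotients converge to \<open>a j\<close> as y tends to 0, uniformly in any parameter on which B
  and \<rho> do not depend.\<close>

lemma taylor_remainder_bound:
  fixes a :: "nat \<Rightarrow> complex"
  assumes a: "\<And>n. norm (a n) \<le> B / \<rho> ^ n" and \<rho>: "\<rho> > 0" and y: "y \<noteq> 0" "norm y \<le> \<rho> / 2"
    and s: "(\<lambda>n. a n * y ^ n) sums F"
  shows "norm ((F - (\<Sum>i<j. a i * y ^ i)) / y ^ j - a j) \<le> 2 * B / \<rho> ^ Suc j * norm y"
proof -
  have "(\<lambda>n. a (n + Suc j) * y ^ (n + Suc j)) sums (F - (\<Sum>i<Suc j. a i * y ^ i))"
    using sums_split_initial_segment[OF s, of "Suc j"] .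
  then have "(\<lambda>n. a (n + Suc j) * y ^ (n + Suc j) / y ^ j) sums ((F - (\<Sum>i<Suc j. a i * y ^ i)) / y ^ j)"
    by (rule sums_divide)
  then have *: "(\<lambda>n. a (n + Suc j) * y ^ (n + Suc j) / y ^ j) sums ((F - (\<Sum>i<j. a i * y ^ i)) / y ^ j - a j)"
    using y by (simp add: field_simps)
  have g: "(\<lambda>n. B / \<rho> ^ Suc j * norm y * (1/2) ^ n) sums (B / \<rho> ^ Suc j * norm y * 2)"
    using sums_mult[OF geometric_sums[of "1/2 :: real"], of "B / \<rho> ^ Suc j * norm y"] by simp
  have B: "B \<ge> 0" using order_trans[OF norm_ge_zero a[of 0]] by simp
  have bd: "norm (a (n + Suc j) * y ^ (n + Suc j) / y ^ j) \<le> B / \<rho> ^ Suc j * norm y * (1/2) ^ n" for n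
  proof -
    have "y ^ (n + Suc j) / y ^ j = y * y ^ n" using y by (simp add: power_add)
    then have "norm (a (n + Suc j) * y ^ (n + Suc j) / y ^ j) = norm (a (n + Suc j)) * (norm y * norm y ^ n)"
      by (metis norm_mult norm_power times_divide_eq_right)
    also have "\<dots> \<le> B / \<rho> ^ (n + Suc j) * (norm y * (\<rho> / 2) ^ n)"
      using y B \<rho> by (intro mult_mono[OF a] power_mono mult_left_mono) auto
    also have "\<dots> = B / \<rho> ^ Suc j * norm y * (1/2) ^ n"
      using \<rho> by (simp add: power_add power_divide field_simps)
    finally show ?thesis .
  qed
  have "norm ((F - (\<Sum>i<j. a i * y ^ i)) / y ^ j - a j) \<le> B / \<rho> ^ Suc j * norm y * 2"
    using norm_sums_le[OF * g bd] .
  then show ?thesis by (simp add: mult.commute mult.left_commute)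
qed

text \<open>Osgood's lemma: the Taylor coefficients in \<open>y\<close> are holomorphic in \<open>x\<close>, being uniform
  limits of difference quotients of \<open>f\<close>.\<close>
lemma germ2_imp_ps_eval:
  assumes "germ2 f"
  shows "\<exists>c e. conv_ps c \<and> e > 0 \<and> (\<forall>x y. norm x < e \<and> norm y < e \<longrightarrow> f (x, y) = ps_eval c x y)"
proof -
  obtain r B where r: "r > 0" and bd: "\<And>x y. norm x < r \<Longrightarrow> norm y < r \<Longrightarrow> norm (f (x, y)) \<le> B"
    and hol: "\<And>A u v. open A \<Longrightarrow> u holomorphic_on A \<Longrightarrow> v holomorphic_on A \<Longrightarrow>
        (\<forall>z\<in>A. norm (u z) < r \<and> norm (v z) < r) \<Longrightarrow> (\<lambda>z. f (u z, v z)) holomorphic_on A"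
  proof -
    from assms obtain r where "hol2 r f" unfolding germ2_def by blast
    then show ?thesis using that unfolding hol2_def by blast
  qed
  define \<rho> where "\<rho> = r / 2"
  have \<rho>: "0 < \<rho>" "\<rho> < r" using r by (auto simp: \<rho>_def)
  have B: "B \<ge> 0" using order_trans[OF norm_ge_zero bd[of 0 0]] r by simp
  define a where "a j x = (deriv ^^ j) (\<lambda>y. f (x, y)) 0 / fact j" for j x
  have holy: "(\<lambda>y. f (x, y)) holomorphic_on ball 0 r" if "norm x < r" for x
    using hol[of "ball 0 r" "\<lambda>_. x" "\<lambda>y. y"] that by (auto intro: holomorphic_intros)
  have holx: "(\<lambda>x. f (x, y)) holomorphic_on ball 0 r" if "norm y < r" for y
    using hol[of "ball 0 r" "\<lambda>x. x" "\<lambda>_. y"] that by (auto intro: holomorphic_intros)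
  have a_bd: "norm (a j x) \<le> B / \<rho> ^ j" if "norm x < r" for j x
    unfolding a_def by (rule taylor_coeff_bound[OF holy bd \<rho>]) (use that in auto)
  have a_sums: "(\<lambda>j. a j x * y ^ j) sums f (x, y)" if "norm x < r" "norm y < r" for x y
    using holomorphic_power_series[OF holy[OF that(1)], of y] that(2) by (simp add: a_def)
  have a_hol: "a j holomorphic_on ball 0 r" for j
  proof (induction j rule: less_induct)
    case (less j)
    have "a j field_differentiable at w" if w: "w \<in> ball 0 r" for w
    proof -
      obtain d where d: "d > 0" "cball w d \<subseteq> ball 0 r" using w open_contains_cball[of "ball 0 r"] open_ball by blast
      have db: "ball w d \<subseteq> ball 0 r" using d by (meson ball_subset_cball order_trans)
      \<comment> \<open>Subtracting the lower terms needs \<open>a i\<close> to be holomorphic for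
        all i < j, hence the strong induction.\<close>
      define g where "g y x = (f (x, y) - (\<Sum>i<j. a i x * y ^ i)) / y ^ j" for y x
      have nz: "\<forall>\<^sub>F y in at (0::complex). y \<noteq> 0 \<and> norm y < \<delta>" if "\<delta> > 0" for \<delta>
        using that by (auto simp: eventually_at dist_norm)
      have "g y holomorphic_on ball 0 r" if "y \<noteq> 0" "norm y < r" for y
        unfolding g_def by (intro holomorphic_intros holx less.IH) (use that in auto)
      then have ev: "\<forall>\<^sub>F y in at 0. continuous_on (cball w d) (g y) \<and> g y holomorphic_on ball w d"
        by (intro eventually_mono[OF nz[OF r]])
          (use d db in \<open>auto intro: holomorphic_on_subset holomorphic_on_imp_continuous_on\<close>)
      have "uniform_limit (cball w d) g (a j) (at 0)"
      proof (rule uniform_limitI)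
        fix e :: real assume e: "e > 0"
        define c where "c = 2 * B / \<rho> ^ Suc j"
        have c: "c \<ge> 0" using B \<rho> by (simp add: c_def)
        have "min (\<rho> / 2) (e / (c + 1)) > 0" using e c \<rho> by auto
        from nz[OF this] show "\<forall>\<^sub>F y in at 0. \<forall>x\<in>cball w d. dist (g y x) (a j x) < e"
        proof eventually_elim
          case (elim y)
          have "dist (g y x) (a j x) < e" if x: "x \<in> cball w d" for x
          proof -
            have xr: "norm x < r" using x d by auto
            have "norm (g y x - a j x) \<le> c * norm y"
              unfolding g_def c_def using elim \<rho>
              by (intro taylor_remainder_bound[OF a_bd[OF xr] \<rho>(1) _ _ a_sums[OF xr]]) auto
            also have "\<dots> \<le> (c + 1) * norm y" by (simp add: distrib_right)
            also have "\<dots> < e" using elim c by (simp add: field_simps)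
            finally show ?thesis by (simp add: dist_norm)
          qed
          then show ?case by blast
        qed
      qed
      from holomorphic_uniform_limit[OF ev this] have "a j holomorphic_on ball w d" by auto
      then show ?thesis using d(1) by (auto intro: holomorphic_on_imp_differentiable_at)
    qed
    then show ?case
      by (auto simp: holomorphic_on_def intro: field_differentiable_at_within)
  qed
  define c where "c i j = (deriv ^^ i) (a j) 0 / fact i" for i j
  have c_bd: "norm (c i j) \<le> B / \<rho> ^ (i + j)" for i j
    using taylor_coeff_bound[OF a_hol a_bd \<rho>, of i j] by (simp add: c_def power_add field_simps)
  have c_sums: "(\<lambda>i. c i j * x ^ i) sums a j x" if "norm x < r" for x j
    using holomorphic_power_series[OF a_hol, of x] that by (simp add: c_def)
  \<comment> \<open>With half the Cauchy radius the majorant becomes B (1/2)^i (1/2)^j, a product of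
    geometric series.\<close>
  define e where "e = \<rho> / 2"
  have e: "e > 0" using \<rho> by (simp add: e_def)
  have geo: "(\<lambda>n. (1/2 :: real) ^ n) summable_on UNIV"
    by (intro norm_summable_imp_summable_on) (auto simp: power_divide[symmetric])
  have "(\<lambda>(i,j). norm (c i j) * e ^ (i + j)) summable_on UNIV"
  proof (rule summable_on_comparison_test)
    have "((\<lambda>(i,j). (1/2) ^ i * (1/2 :: real) ^ j)) summable_on UNIV \<times> UNIV"
      by (rule summable_on_SigmaI[where g = "\<lambda>i. (1/2) ^ i * (\<Sum>\<^sub>\<infinity>j. (1/2) ^ j)"])
         (auto intro!: has_sum_cmult_right has_sum_infsum summable_on_cmult_left geo)
    then show "(\<lambda>p. B * (case p of (i,j) \<Rightarrow> (1/2) ^ i * (1/2 :: real) ^ j)) summable_on UNIV"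
      by (intro summable_on_cmult_right) simp
    fix p :: "nat \<times> nat"
    obtain i j where p: "p = (i, j)" by (cases p)
    have "norm (c i j) * e ^ (i + j) \<le> B / \<rho> ^ (i + j) * e ^ (i + j)"
      using c_bd e by (intro mult_right_mono) auto
    also have "\<dots> = B * ((1/2) ^ i * (1/2) ^ j)"
      using \<rho> by (simp add: e_def power_add power_divide field_simps)
    finally show "(case p of (i, j) \<Rightarrow> norm (c i j) * e ^ (i + j)) \<le> B * (case p of (i,j) \<Rightarrow> (1/2) ^ i * (1/2 :: real) ^ j)"
      by (simp add: p)
    show "0 \<le> (case p of (i, j) \<Rightarrow> norm (c i j) * e ^ (i + j))" using e by (simp add: p)
  qed
  note sm = this
  have "f (x, y) = ps_eval c x y" if xy: "norm x < e" "norm y < e" for x y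
  proof -
    have xr: "norm x < r" "norm y < r" using xy \<rho> by (auto simp: e_def)
    have hs: "((\<lambda>(i,j). c i j * x ^ i * y ^ j) has_sum ps_eval c x y) (UNIV \<times> UNIV)"
      using ps_eval_has_sum[OF sm] xy by simp
    \<comment> \<open>Swapping the indices groups the terms by powers of y, so that the inner sums
      are the expansions of \<open>a j x\<close>.\<close>
    have hs': "((\<lambda>(j,i). c i j * x ^ i * y ^ j) has_sum ps_eval c x y) (UNIV \<times> UNIV)"
      using iffD1[OF has_sum_swap hs] by (simp add: case_prod_unfold)
    have in_sum: "((\<lambda>i. c i j * x ^ i * y ^ j) has_sum (a j x * y ^ j)) UNIV" for j
    proof -
      have "(\<lambda>i. c i j * x ^ i * y ^ j) summable_on UNIV"
        using summable_on_SigmaD1[OF has_sum_imp_summable[OF hs'], of j] by simp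
      then have "((\<lambda>i. c i j * x ^ i * y ^ j) has_sum (\<Sum>\<^sub>\<infinity>i. c i j * x ^ i * y ^ j)) UNIV"
        by (rule has_sum_infsum)
      moreover from has_sum_imp_sums[OF this] have "(\<Sum>\<^sub>\<infinity>i. c i j * x ^ i * y ^ j) = a j x * y ^ j"
        using sums_unique2 sums_mult2[OF c_sums[OF xr(1), of j], of "y ^ j"] by blast
      ultimately show ?thesis by simp
    qed
    have "((\<lambda>j. a j x * y ^ j) has_sum ps_eval c x y) UNIV"
      by (rule has_sum_SigmaD[OF hs']) (use in_sum in simp)
    from has_sum_imp_sums[OF this] show ?thesis
      using a_sums[OF xr] sums_unique2 by blast
  qed
  moreover have "conv_ps c" unfolding conv_ps_def using sm e by blast
  ultimately show ?thesis using e by blast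
qed

section \<open>The ring of germs\<close>

text \<open>The norm on pairs is Euclidean, hence the halved radius in one direction. This
  translates between filters, which combine neighbourhoods silently, and the explicit polydiscs of
  \<open>prod_ideal\<close>.\<close>

lemma eventually_nhds_polydisc:
  "(\<forall>\<^sub>F z in nhds (0 :: complex \<times> complex). Pr z) \<longleftrightarrow>
     (\<exists>e>0. \<forall>x y. norm x < e \<and> norm y < e \<longrightarrow> Pr (x, y))"
proof
  assume "\<forall>\<^sub>F z in nhds (0 :: complex \<times> complex). Pr z"
  then obtain d where d: "d > 0" "\<And>z. dist z 0 < d \<Longrightarrow> Pr z"
    unfolding eventually_nhds_metric by blast
  have "Pr (x, y)" if "norm x < d / 2" "norm y < d / 2" for x y
    using d(2)[of "(x, y)"] norm_Pair_le[of x y] that by simp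
  then show "\<exists>e>0. \<forall>x y. norm x < e \<and> norm y < e \<longrightarrow> Pr (x, y)"
    using d(1) by (intro exI[of _ "d / 2"]) auto
next
  assume "\<exists>e>0. \<forall>x y. norm x < e \<and> norm y < e \<longrightarrow> Pr (x, y)"
  then obtain e where e: "e > 0" "\<And>x y. norm x < e \<Longrightarrow> norm y < e \<Longrightarrow> Pr (x, y)" by blast
  have "Pr z" if "dist z 0 < e" for z
    using e(2)[of "fst z" "snd z"] norm_fst_le[of "fst z" "snd z"] norm_snd_le[of "snd z" "fst z"] that
    by simp
  then show "\<forall>\<^sub>F z in nhds (0 :: complex \<times> complex). Pr z"
    using e(1) unfolding eventually_nhds_metric by blast
qed

lemma hol2_mono: "hol2 r f \<Longrightarrow> 0 < r' \<Longrightarrow> r' \<le> r \<Longrightarrow> hol2 r' f"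
  unfolding hol2_def by (meson order_less_le_trans)

lemma hol2_holomorphic:
  assumes "hol2 r f" "open A" "u holomorphic_on A" "v holomorphic_on A"
    "\<And>z. z \<in> A \<Longrightarrow> norm (u z) < r" "\<And>z. z \<in> A \<Longrightarrow> norm (v z) < r"
  shows "(\<lambda>z. f (u z, v z)) holomorphic_on A"
  using assms unfolding hol2_def by blast

lemma germ2_common:
  assumes "germ2 f" "germ2 g"
  obtains r where "hol2 r f" "hol2 r g"
proof -
  obtain r1 r2 where r: "hol2 r1 f" "hol2 r2 g" using assms unfolding germ2_def by blast
  then have "r1 > 0" "r2 > 0" unfolding hol2_def by auto
  with r show ?thesis by (intro that[of "min r1 r2"]) (auto intro: hol2_mono)
qed

lemma germ2_cong:
  assumes "germ2 f" "\<forall>\<^sub>F z in nhds 0. f z = g z"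
  shows "germ2 g"
proof -
  obtain r where r: "hol2 r f" using assms unfolding germ2_def by blast
  obtain e where e: "e > 0" "\<And>x y. norm x < e \<and> norm y < e \<Longrightarrow> f (x, y) = g (x, y)"
    using assms(2) unfolding eventually_nhds_polydisc by blast
  define d where "d = min e r"
  have d: "d > 0" using e r by (auto simp: d_def hol2_def)
  have rd: "hol2 d f" using r d by (auto intro: hol2_mono simp: d_def)
  have eq: "f (x, y) = g (x, y)" if "norm x < d" "norm y < d" for x y
    using that e(2) by (simp add: d_def)
  have "(\<lambda>z. g (u z, v z)) holomorphic_on A" if "open A" "u holomorphic_on A" "v holomorphic_on A"
     "\<forall>z\<in>A. norm (u z) < d \<and> norm (v z) < d" for A u v
    by (rule holomorphic_transform[OF hol2_holomorphic[OF rd that(1-3)]]) (use that eq in auto)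
  moreover obtain B where "\<forall>x y. norm x < d \<longrightarrow> norm y < d \<longrightarrow> norm (f (x, y)) \<le> B"
    using rd unfolding hol2_def by blast
  ultimately have "hol2 d g" unfolding hol2_def using d eq by (metis (no_types, lifting))
  then show ?thesis unfolding germ2_def by blast
qed

text \<open>Identifies the germs with C{x,y}: one direction is Osgood's lemma, the other holds
  because \<open>germ2\<close> depends only on the values near the origin.\<close>

lemma germ2_iff_ps_eval:
  "germ2 f \<longleftrightarrow> (\<exists>c. conv_ps c \<and> (\<forall>\<^sub>F z in nhds 0. f z = ps_eval c (fst z) (snd z)))"
proof
  assume "germ2 f"
  from germ2_imp_ps_eval[OF this]
  show "\<exists>c. conv_ps c \<and> (\<forall>\<^sub>F z in nhds 0. f z = ps_eval c (fst z) (snd z))"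
    unfolding eventually_nhds_polydisc by auto
next
  assume "\<exists>c. conv_ps c \<and> (\<forall>\<^sub>F z in nhds 0. f z = ps_eval c (fst z) (snd z))"
  then obtain c where c: "conv_ps c" "\<forall>\<^sub>F z in nhds 0. f z = ps_eval c (fst z) (snd z)" by blast
  have "\<forall>\<^sub>F z in nhds 0. ps_eval c (fst z) (snd z) = f z"
    using c(2) by (rule eventually_mono) simp
  then show "germ2 f" by (rule germ2_cong[OF ps_eval_germ2[OF c(1)]])
qed

lemma germ2_bounded:
  assumes "germ2 f"
  shows "\<exists>B\<ge>0. \<forall>\<^sub>F z in nhds 0. norm (f z) \<le> B"
proof -
  obtain r B where r: "r > 0" and B: "\<forall>x y. norm x < r \<longrightarrow> norm y < r \<longrightarrow> norm (f (x, y)) \<le> B"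
    using assms unfolding germ2_def hol2_def by blast
  then have "norm (f (0,0)) \<le> B" by simp
  then have "B \<ge> 0" using norm_ge_zero order_trans by blast
  then show ?thesis using r B unfolding eventually_nhds_polydisc by blast
qed

lemma germ2_const [simp]: "germ2 (\<lambda>z. a)"
  unfolding germ2_def hol2_def by (intro exI[of _ 1]) auto

lemma germ2_fst [simp]: "germ2 (\<lambda>z. fst z)"
  unfolding germ2_def hol2_def by (intro exI[of _ 1]) (auto intro: less_imp_le)

lemma germ2_snd [simp]: "germ2 (\<lambda>z. snd z)"
  unfolding germ2_def hol2_def by (intro exI[of _ 1]) (auto intro: less_imp_le)

lemma germ2_add:
  assumes "germ2 f" "germ2 g"
  shows "germ2 (\<lambda>z. f z + g z)"
proof -
  obtain r where r: "hol2 r f" "hol2 r g" using germ2_common[OF assms] .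
  obtain B B' where "\<forall>x y. norm x < r \<longrightarrow> norm y < r \<longrightarrow> norm (f (x, y)) \<le> B"
     "\<forall>x y. norm x < r \<longrightarrow> norm y < r \<longrightarrow> norm (g (x, y)) \<le> B'"
    using r unfolding hol2_def by blast
  then have "\<forall>x y. norm x < r \<longrightarrow> norm y < r \<longrightarrow> norm (f (x, y) + g (x, y)) \<le> B + B'"
    by (meson norm_triangle_mono)
  moreover have "r > 0" using r unfolding hol2_def by blast
  ultimately have "hol2 r (\<lambda>z. f z + g z)" unfolding hol2_def
    using hol2_holomorphic[OF r(1)] hol2_holomorphic[OF r(2)] by (auto intro!: holomorphic_on_add)
  then show ?thesis unfolding germ2_def by blast
qed

lemma germ2_mult:
  assumes "germ2 f" "germ2 g"
  shows "germ2 (\<lambda>z. f z * g z)"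
proof -
  obtain r where r: "hol2 r f" "hol2 r g" using germ2_common[OF assms] .
  obtain B B' where B: "\<forall>x y. norm x < r \<longrightarrow> norm y < r \<longrightarrow> norm (f (x, y)) \<le> B"
     "\<forall>x y. norm x < r \<longrightarrow> norm y < r \<longrightarrow> norm (g (x, y)) \<le> B'"
    using r unfolding hol2_def by blast
  have r0: "r > 0" using r unfolding hol2_def by blast
  have "B \<ge> 0" using B(1) r0 by (metis norm_ge_zero norm_zero order_trans)
  then have "norm (f (x, y) * g (x, y)) \<le> B * B'" if "norm x < r" "norm y < r" for x y
    unfolding norm_mult using B that by (intro mult_mono) auto
  then have "hol2 r (\<lambda>z. f z * g z)" unfolding hol2_def
    using r0 hol2_holomorphic[OF r(1)] hol2_holomorphic[OF r(2)] by (auto intro!: holomorphic_on_mult)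
  then show ?thesis unfolding germ2_def by blast
qed

lemma germ2_minus: "germ2 f \<Longrightarrow> germ2 (\<lambda>z. - f z)"
  using germ2_mult[OF germ2_const[of "-1"]] by simp

lemma germ2_diff: "germ2 f \<Longrightarrow> germ2 g \<Longrightarrow> germ2 (\<lambda>z. f z - g z)"
  using germ2_add[OF _ germ2_minus] by (simp add: diff_conv_add_uminus del: add_uminus_conv_diff)

lemma germ2_power: "germ2 f \<Longrightarrow> germ2 (\<lambda>z. f z ^ n)"
  by (induction n) (auto intro: germ2_mult)

lemma germ2_prod: "(\<And>i. i \<in> I \<Longrightarrow> germ2 (f i)) \<Longrightarrow> germ2 (\<lambda>z. \<Prod>i\<in>I. f i z)"
  by (induction I rule: infinite_finite_induct) (auto intro: germ2_mult)

section \<open>Substituting one-variable holomorphic functions into germs\<close>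

lemma holomorphic_small:
  assumes "g holomorphic_on ball 0 d" "d > 0" "g 0 = 0" "r > 0"
  shows "\<exists>\<delta>>0. \<delta> \<le> d \<and> (\<forall>x. norm x < \<delta> \<longrightarrow> norm (g x :: complex) < r)"
proof -
  have "isCont g 0"
    using assms(1,2) by (metis centre_in_ball continuous_on_interior holomorphic_on_imp_continuous_on interior_ball)
  then obtain \<delta> where "\<delta> > 0" "\<And>x. norm (x - 0) < \<delta> \<Longrightarrow> norm (g x - g 0) < r"
    using assms(4) unfolding continuous_at_eps_delta dist_norm by blast
  then show ?thesis using assms by (intro exI[of _ "min \<delta> d"]) auto
qed

lemma germ2_holomorphic_fst:
  assumes "g holomorphic_on ball 0 d" "d > 0"
  shows "germ2 (\<lambda>z. g (fst z))"
proof -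
  obtain \<delta> where \<delta>: "\<delta> > 0" "\<delta> \<le> d" "\<And>x. norm x < \<delta> \<Longrightarrow> norm (g x - g 0) < 1"
    using holomorphic_small[of "\<lambda>x. g x - g 0" d 1, OF holomorphic_on_diff[OF assms(1) holomorphic_on_const]]
      assms(2) by auto
  have "norm (g x) \<le> norm (g 0) + 1" if "norm x < \<delta>" for x
    using \<delta>(3)[OF that] norm_triangle_sub[of "g x" "g 0"] by simp
  moreover have "(\<lambda>z. g (u z)) holomorphic_on A"
    if "u holomorphic_on A" "\<forall>z\<in>A. norm (u z) < \<delta>" for A u
    using holomorphic_on_compose_gen[OF that(1) assms(1)] that(2) \<delta>(2) by (force simp: o_def)
  ultimately have "hol2 \<delta> (\<lambda>z. g (fst z))"
    unfolding hol2_def using \<delta>(1) by auto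
  then show ?thesis unfolding germ2_def by blast
qed

lemma germ2_shear:
  assumes "germ2 f" and g: "g holomorphic_on ball 0 d" "d > 0" "g 0 = 0"
  shows "germ2 (\<lambda>z. f (fst z, snd z + g (fst z)))"
proof -
  obtain r where r: "hol2 r f" using assms(1) unfolding germ2_def by blast
  then have r0: "r > 0" unfolding hol2_def by blast
  obtain \<delta> where \<delta>: "\<delta> > 0" "\<delta> \<le> d" "\<And>x. norm x < \<delta> \<Longrightarrow> norm (g x) < r / 2"
    using holomorphic_small[OF g half_gt_zero[OF r0]] by blast
  \<comment> \<open>Half of the radius is left for y and half for \<open>g x\<close>, so that the
    sum stays in the polydisc of f.\<close>
  define e where "e = min \<delta> (r / 2)"
  have e: "e > 0" "e \<le> \<delta>" "e \<le> r / 2" using \<delta> r0 by (auto simp: e_def)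
  have sm: "norm (y + g x) < r" if "norm x < e" "norm y < e" for x y
    using norm_triangle_ineq[of y "g x"] \<delta>(3)[of x] that e by linarith
  obtain B where "\<forall>x y. norm x < r \<longrightarrow> norm y < r \<longrightarrow> norm (f (x, y)) \<le> B"
    using r unfolding hol2_def by blast
  then have "\<forall>x y. norm x < e \<longrightarrow> norm y < e \<longrightarrow> norm (f (x, y + g x)) \<le> B"
    using sm e r0 by auto
  moreover have "(\<lambda>z. f (u z, v z + g (u z))) holomorphic_on A"
    if "open A" "u holomorphic_on A" "v holomorphic_on A"
     "\<forall>z\<in>A. norm (u z) < e \<and> norm (v z) < e" for A u v
  proof (rule hol2_holomorphic[OF r that(1,2)])
    have "(\<lambda>z. g (u z)) holomorphic_on A"
      using holomorphic_on_compose_gen[OF that(2) g(1)] that(4) \<delta>(2) e by (force simp: o_def)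
    then show "(\<lambda>z. v z + g (u z)) holomorphic_on A" using that(3) by (rule holomorphic_on_add[rotated])
  qed (use that(4) e r0 sm in auto)
  ultimately have "hol2 e (\<lambda>z. f (fst z, snd z + g (fst z)))"
    unfolding hol2_def using e by auto
  then show ?thesis unfolding germ2_def by blast
qed

lemma germ2_curve_holomorphic:
  assumes "germ2 f" and g: "g holomorphic_on ball 0 d" "d > 0" "g 0 = 0"
  shows "\<exists>\<delta>>0. (\<lambda>z. f (z, g z)) holomorphic_on ball 0 \<delta>"
proof -
  obtain r where r: "hol2 r f" using assms(1) unfolding germ2_def by blast
  then have r0: "r > 0" unfolding hol2_def by blast
  obtain \<delta> where \<delta>: "\<delta> > 0" "\<delta> \<le> d" "\<And>x. norm x < \<delta> \<Longrightarrow> norm (g x) < r"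
    using holomorphic_small[OF g r0] by blast
  have "(\<lambda>z. f (z, g z)) holomorphic_on ball 0 (min \<delta> r)"
    using \<delta> by (intro hol2_holomorphic[OF r]) (auto intro!: holomorphic_on_subset[OF g(1)])
  then show ?thesis using \<delta>(1) r0 by (intro exI[of _ "min \<delta> r"]) auto
qed

section \<open>Division by y and by y + g(x)\<close>

lemma germ2_divide_snd:
  assumes "germ2 f"
  shows "\<exists>g. germ2 g \<and> (\<forall>\<^sub>F z in nhds 0. f z = f (fst z, 0) + snd z * g z)"
proof -
  obtain c where c: "conv_ps c" "\<forall>\<^sub>F z in nhds 0. f z = ps_eval c (fst z) (snd z)"
    using assms germ2_iff_ps_eval by blast
  obtain r where r: "r > 0" and sm: "(\<lambda>(i,j). norm (c i j) * r ^ (i + j)) summable_on UNIV"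
    using c(1) unfolding conv_ps_def by blast
  define d where "d i j = c i (Suc j)" for i j
  \<comment> \<open>The image of this shift consists of the terms divisible by y; its complement is
    the row j = 0, which sums to the value at y = 0.\<close>
  define h :: "nat \<times> nat \<Rightarrow> nat \<times> nat" where "h = (\<lambda>(i,j). (i, Suc j))"
  have h: "inj h" by (auto simp: h_def inj_on_def)
  have "(\<lambda>(i,j). norm (c i j) * r ^ (i + j)) summable_on range h"
    using sm by (rule summable_on_subset) auto
  then have "(\<lambda>p. (1 / r) * ((\<lambda>(i,j). norm (c i j) * r ^ (i + j)) \<circ> h) p) summable_on UNIV"
    unfolding summable_on_reindex[OF h] by (rule summable_on_cmult_right)
  also have "(\<lambda>p. (1 / r) * ((\<lambda>(i,j). norm (c i j) * r ^ (i + j)) \<circ> h) p) = (\<lambda>(i,j). norm (d i j) * r ^ (i + j))"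
    using r by (auto simp: fun_eq_iff h_def d_def)
  finally have smd: "(\<lambda>(i,j). norm (d i j) * r ^ (i + j)) summable_on UNIV" .
  have "ps_eval c x y = ps_eval c x 0 + y * ps_eval d x y" if xy: "norm x < r" "norm y < r" for x y
  proof -
    have "((\<lambda>(i,j). d i j * x ^ i * y ^ j) has_sum ps_eval d x y) UNIV"
      by (rule ps_eval_has_sum[OF smd]) (use xy in auto)
    then have "((\<lambda>p. y * (case p of (i,j) \<Rightarrow> d i j * x ^ i * y ^ j)) has_sum (y * ps_eval d x y)) UNIV"
      by (rule has_sum_cmult_right)
    also have "(\<lambda>p. y * (case p of (i,j) \<Rightarrow> d i j * x ^ i * y ^ j)) = (\<lambda>(i,j). c i j * x ^ i * y ^ j) \<circ> h"
      by (auto simp: fun_eq_iff h_def d_def)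
    finally have 1: "((\<lambda>(i,j). c i j * x ^ i * y ^ j) has_sum (y * ps_eval d x y)) (range h)"
      unfolding has_sum_reindex[OF h] .
    have rest: "- range h = UNIV \<times> {0}"
    proof -
      have "(i, j) \<in> range h \<longleftrightarrow> j \<noteq> 0" for i j by (cases j) (auto simp: h_def image_def)
      then show ?thesis by auto
    qed
    have "((\<lambda>(i,j). c i j * x ^ i * 0 ^ j) has_sum ps_eval c x 0) UNIV"
      by (rule ps_eval_has_sum[OF sm]) (use xy r in auto)
    also have "?this \<longleftrightarrow> ((\<lambda>(i,j). c i j * x ^ i * y ^ j) has_sum ps_eval c x 0) (- range h)"
      by (rule has_sum_cong_neutral) (auto simp: rest)
    finally have "((\<lambda>(i,j). c i j * x ^ i * y ^ j) has_sum ps_eval c x 0) (- range h)" .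
    then have "((\<lambda>(i,j). c i j * x ^ i * y ^ j) has_sum (y * ps_eval d x y + ps_eval c x 0)) (range h \<union> - range h)"
      by (intro has_sum_Un_disjoint 1) auto
    moreover have "((\<lambda>(i,j). c i j * x ^ i * y ^ j) has_sum ps_eval c x y) UNIV"
      by (rule ps_eval_has_sum[OF sm]) (use xy in auto)
    ultimately have "ps_eval c x y = y * ps_eval d x y + ps_eval c x 0"
      using has_sum_unique by (auto simp: Compl_partition)
    then show ?thesis by simp
  qed
  note eq = this
  obtain e where e: "e > 0" "\<And>x y. norm x < e \<and> norm y < e \<Longrightarrow> f (x, y) = ps_eval c x y"
    using c(2) unfolding eventually_nhds_polydisc by auto
  have eq': "f (x, y) = f (x, 0) + y * ps_eval d x y" if "norm x < min e r" "norm y < min e r" for x y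
    using e(2)[of x y] e(2)[of x 0] eq[of x y] that e(1) by simp
  have "\<forall>\<^sub>F z in nhds 0. f z = f (fst z, 0) + snd z * ps_eval d (fst z) (snd z)"
    unfolding eventually_nhds_polydisc fst_conv snd_conv using r e(1)
    by (intro exI[of _ "min e r"] conjI allI impI eq') simp_all
  moreover have "conv_ps d" unfolding conv_ps_def using r smd by blast
  ultimately show ?thesis using ps_eval_germ2 by blast
qed

text \<open>Shearing reduces this to division by \<open>y\<close>.\<close>
lemma germ2_divide:
  assumes "germ2 f" and g: "g holomorphic_on ball 0 d" "d > 0" "g 0 = 0"
    and zero: "\<forall>\<^sub>F x in nhds 0. f (x, - g x) = 0"
  shows "\<exists>h. germ2 h \<and> (\<forall>\<^sub>F z in nhds 0. f z = (snd z + g (fst z)) * h z)"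
proof -
  define F where "F z = f (fst z, snd z + (- g (fst z)))" for z
  have "germ2 F" unfolding F_def
    using g by (intro germ2_shear[OF assms(1)]) (auto intro: holomorphic_intros)
  then obtain k where k: "germ2 k" "\<forall>\<^sub>F z in nhds 0. F z = F (fst z, 0) + snd z * k z"
    using germ2_divide_snd by blast
  obtain e where e: "e > 0" "\<And>x y. norm x < e \<and> norm y < e \<Longrightarrow> F (x, y) = F (x, 0) + y * k (x, y)"
    using k(2) unfolding eventually_nhds_polydisc by auto
  obtain e' where e': "e' > 0" "\<And>x. norm x < e' \<Longrightarrow> f (x, - g x) = 0"
    using zero unfolding eventually_nhds_metric by auto
  obtain \<delta> where \<delta>: "\<delta> > 0" "\<And>x. norm x < \<delta> \<Longrightarrow> norm (g x) < e / 2"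
    using holomorphic_small[OF g half_gt_zero[OF e(1)]] by blast
  have "f (x, y) = (y + g x) * k (x, y + g x)"
    if "norm x < Min {e, e', \<delta>, e / 2}" "norm y < Min {e, e', \<delta>, e / 2}" for x y
  proof -
    have "norm (y + g x) < e" using norm_triangle_ineq[of y "g x"] \<delta>(2)[of x] that by simp
    then have "F (x, y + g x) = F (x, 0) + (y + g x) * k (x, y + g x)" using e(2)[of x "y + g x"] that by simp
    then show ?thesis using e'(2)[of x] that by (simp add: F_def)
  qed
  then have "\<forall>\<^sub>F z in nhds 0. f z = (snd z + g (fst z)) * k (fst z, snd z + g (fst z))"
    unfolding eventually_nhds_polydisc using e(1) e'(1) \<delta>(1)
    by (intro exI[of _ "Min {e, e', \<delta>, e / 2}"] conjI allI impI) simp_all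
  moreover have "germ2 (\<lambda>z. k (fst z, snd z + g (fst z)))" by (rule germ2_shear[OF k(1) g])
  ultimately show ?thesis by blast
qed

section \<open>Orders along curves\<close>

text \<open>Splitting off the full power of x leaves a cofactor that is nonzero at 0, hence bounded
  above and below near 0. The field stays general because both real weights and complex Taylor
  polynomials are treated.\<close>

lemma poly_bigtheta_order:
  fixes p :: "'a :: real_normed_field poly"
  assumes "p \<noteq> 0"
  shows "(\<lambda>x. norm (poly p (of_real x))) \<in> \<Theta>[at_right 0](\<lambda>x::real. x ^ order 0 p)"
proof -
  obtain q where q: "p = [:0, 1:] ^ order 0 p * q" "\<not> [:0, 1:] dvd q"
    using order_decomp[OF assms, of 0] by auto
  then have q0: "poly q 0 \<noteq> 0" using poly_eq_0_iff_dvd[of q 0] by simp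
  have "((\<lambda>x::real. norm (poly q (of_real x)) / 1) \<longlongrightarrow> norm (poly q (of_real 0))) (at_right 0)"
    unfolding div_by_1 by (intro tendsto_intros)
  then have 1: "(\<lambda>x::real. norm (poly q (of_real x))) \<in> \<Theta>[at_right 0](\<lambda>_. 1)"
    using q0 by (intro bigthetaI_tendsto) auto
  have "norm (poly p (of_real x)) = norm (poly ([:0, 1:] ^ order 0 p * q) (of_real x))" for x :: real
    using q(1) by simp
  then have "norm (poly p (of_real x)) = \<bar>x\<bar> ^ order 0 p * norm (poly q (of_real x))" for x :: real
    by (simp add: norm_mult norm_power poly_power)
  moreover have "(\<lambda>x::real. \<bar>x\<bar> ^ order 0 p) \<in> \<Theta>[at_right 0](\<lambda>x. x ^ order 0 p)"
    by (intro bigthetaI_cong) (auto simp: eventually_at_right_less eventually_at_filter)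
  from landau_theta.mult[OF this 1]
  have "(\<lambda>x::real. \<bar>x\<bar> ^ order 0 p * norm (poly q (of_real x))) \<in> \<Theta>[at_right 0](\<lambda>x. x ^ order 0 p)"
    by simp
  ultimately show ?thesis by simp
qed

lemma power_bigo_at_right_0:
  assumes "b \<le> a"
  shows "(\<lambda>x::real. x ^ a) \<in> O[at_right 0](\<lambda>x. x ^ b)"
proof (rule landau_o.bigI[of 1])
  have "\<forall>\<^sub>F x::real in at_right 0. 0 < x \<and> x < 1"
    using eventually_at_right_real[of 0 1] by (auto elim: eventually_mono)
  then show "\<forall>\<^sub>F x::real in at_right 0. norm (x ^ a) \<le> 1 * norm (x ^ b)"
    by eventually_elim (use assms in \<open>auto intro: power_decreasing\<close>)
qed auto

lemma power_bigo_at_right_0D: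
  assumes "(\<lambda>x::real. x ^ a) \<in> O[at_right 0](\<lambda>x. x ^ b)"
  shows "b \<le> a"
proof (rule ccontr)
  assume "\<not> b \<le> a"
  then have ab: "b = a + Suc (b - Suc a)" by simp
  obtain C where "\<forall>\<^sub>F x::real in at_right 0. norm (x ^ a) \<le> C * norm (x ^ b)"
    using assms by (elim landau_o.bigE)
  moreover have "\<forall>\<^sub>F x::real in at_right 0. 0 < x" by (rule eventually_at_right_less)
  ultimately have "\<forall>\<^sub>F x::real in at_right 0. 1 \<le> C * x ^ Suc (b - Suc a)"
  proof eventually_elim
    case (elim x)
    then have "x ^ a \<le> x ^ a * (C * x ^ Suc (b - Suc a))"
      by (subst (asm) ab) (simp add: power_add mult_ac)
    then show ?case using elim by (simp add: mult_le_cancel_left1)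
  qed
  moreover have "((\<lambda>x::real. C * x ^ Suc (b - Suc a)) \<longlongrightarrow> C * 0 ^ Suc (b - Suc a)) (at_right 0)"
    by (intro tendsto_intros)
  ultimately have "1 \<le> C * 0 ^ Suc (b - Suc a)"
    by (intro tendsto_lowerbound[of "\<lambda>x::real. C * x ^ Suc (b - Suc a)"]) auto
  then show False by simp
qed

text \<open>Both summands are nonnegative, so they cannot cancel and the smaller order wins. The
  alternative records which summand attains it; this later decides between the two generators of an
  ideal. The condition \<open>r \<noteq> 0\<close> guards \<open>order\<close>, which is meaningful
  only for nonzero polynomials.\<close>

lemma weight_bigtheta:
  fixes r :: "real poly"
  shows "\<exists>e. (\<lambda>x. \<bar>poly r x\<bar> + x ^ m) \<in> \<Theta>[at_right 0](\<lambda>x. x ^ e) \<and> (e = m \<or> r \<noteq> 0 \<and> e = order 0 r)"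
proof (cases "r = 0")
  case True then show ?thesis by (intro exI[of _ m]) simp
next
  case False
  define e where "e = min m (order 0 r)"
  have r: "(\<lambda>x. \<bar>poly r x\<bar>) \<in> \<Theta>[at_right 0](\<lambda>x. x ^ order 0 r)"
    using poly_bigtheta_order[OF False] by simp
  have pos: "\<forall>\<^sub>F x::real in at_right 0. 0 < x" by (rule eventually_at_right_less)
  have "(\<lambda>x. \<bar>poly r x\<bar> + x ^ m) \<in> O[at_right 0](\<lambda>x. x ^ e)"
    by (intro sum_in_bigo landau_o.big_trans[OF bigthetaD1[OF r]] power_bigo_at_right_0) (auto simp: e_def)
  moreover have "(\<lambda>x. x ^ e) \<in> O[at_right 0](\<lambda>x. \<bar>poly r x\<bar> + x ^ m)"
  proof (cases "m \<le> order 0 r")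
    case True
    then show ?thesis
      by (intro landau_o.bigI[of 1] eventually_mono[OF pos]) (auto simp: e_def)
  next
    case False
    have "(\<lambda>x. x ^ e) \<in> O[at_right 0](\<lambda>x. \<bar>poly r x\<bar>)"
      using r False by (simp add: e_def bigtheta_def bigomega_iff_bigo min_def)
    also have "(\<lambda>x. \<bar>poly r x\<bar>) \<in> O[at_right 0](\<lambda>x. \<bar>poly r x\<bar> + x ^ m)"
      by (intro landau_o.bigI[of 1] eventually_mono[OF pos]) auto
    finally show ?thesis .
  qed
  ultimately have "(\<lambda>x. \<bar>poly r x\<bar> + x ^ m) \<in> \<Theta>[at_right 0](\<lambda>x. x ^ e)"
    by (simp add: bigtheta_def bigomega_iff_bigo)
  then show ?thesis using False by (intro exI[of _ e]) (auto simp: e_def min_def)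
qed

lemma holomorphic_tendsto_norm_at_right:
  assumes "G holomorphic_on ball 0 d" "d > 0"
  shows "((\<lambda>x. norm (G (complex_of_real x))) \<longlongrightarrow> norm (G 0)) (at_right 0)"
proof -
  have "isCont G 0"
    using assms by (metis centre_in_ball continuous_on_interior holomorphic_on_imp_continuous_on interior_ball)
  then have "((\<lambda>x. G (complex_of_real x)) \<longlongrightarrow> G (of_real 0)) (at_right 0)"
    by (intro isCont_tendsto_compose[where g = G] tendsto_intros) simp
  then show ?thesis using tendsto_norm by fastforce
qed

text \<open>A bound on the positive real axis is enough: once v powers are split off, one more power
  in the bound forces the cofactor to vanish at 0 by continuity, and its difference quotient extends
  holomorphically.\<close>

lemma holomorphic_factor_power:
  assumes "F holomorphic_on ball 0 d" "d > 0"
    and "(\<lambda>x. norm (F (complex_of_real x))) \<in> O[at_right 0](\<lambda>x. x ^ v)"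
  shows "\<exists>H. H holomorphic_on ball 0 d \<and> (\<forall>z\<in>ball 0 d. F z = z ^ v * H z)"
  using assms(3)
proof (induction v)
  case 0
  show ?case using assms(1) by (intro exI[of _ F]) auto
next
  case (Suc v)
  have "(\<lambda>x. norm (F (complex_of_real x))) \<in> O[at_right 0](\<lambda>x. x ^ v)"
    by (rule landau_o.big_trans[OF Suc.prems power_bigo_at_right_0]) simp
  from Suc.IH[OF this] obtain H where H: "H holomorphic_on ball 0 d"
    "\<And>z. z \<in> ball 0 d \<Longrightarrow> F z = z ^ v * H z" by blast
  obtain C where C: "\<forall>\<^sub>F x in at_right 0. norm (norm (F (complex_of_real x))) \<le> C * norm (x ^ Suc v)"
    using Suc.prems by (elim landau_o.bigE)
  have "\<forall>\<^sub>F x::real in at_right 0. 0 < x \<and> x < d"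
    using eventually_at_right_real[OF assms(2)] by (auto elim: eventually_mono)
  with C have ev: "\<forall>\<^sub>F x in at_right 0. norm (H (complex_of_real x)) \<le> C * x"
  proof eventually_elim
    case (elim x)
    then have "x ^ v * norm (H (of_real x)) \<le> x ^ v * (C * x)"
      using H(2)[of "of_real x"] by (simp add: norm_mult norm_power mult_ac)
    then show ?case using elim by (simp add: mult_le_cancel_left)
  qed
  note lim = holomorphic_tendsto_norm_at_right[OF H(1) assms(2)]
  have "((\<lambda>x. C * x) \<longlongrightarrow> C * 0) (at_right 0)" by (intro tendsto_intros)
  from tendsto_le[OF _ this lim ev] have H0: "H 0 = 0" by simp
  define K where "K z = (if z = 0 then deriv H 0 else (H z - H 0) / (z - 0))" for z
  have "K holomorphic_on ball 0 d" unfolding K_def by (rule pole_lemma_open[OF H(1)]) simp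
  moreover have "F z = z ^ Suc v * K z" if "z \<in> ball 0 d" for z
    using H(2)[OF that] H0 by (auto simp: K_def)
  ultimately show ?case by blast
qed

section \<open>Weighted truncation of series along y = s x^m\<close>

lemma finite_weighted_pairs:
  fixes m v :: nat
  assumes "m > 0"
  shows "finite {(i, j). i + m * j < v}"
proof (rule finite_subset)
  have "i \<le> v \<and> j \<le> v" if "i + m * j < v" for i j
  proof -
    have "j \<le> m * j" using assms by simp
    then show ?thesis using that by linarith
  qed
  then show "{(i, j). i + m * j < v} \<subseteq> {..v} \<times> {..v}" by auto
qed auto

text \<open>On the curve x has weight 1 and y has weight m. The terms of weight at least v are
  together dominated by x^v times a convergent majorant.\<close>

lemma ps_eval_curve_truncation:
  fixes s :: real and v m :: nat
  assumes r: "r > 0" and sm: "(\<lambda>(i,j). norm (c i j) * r ^ (i + j)) summable_on UNIV" and m: "m > 0"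
  defines "I \<equiv> {(i,j). i + m * j < v}"
  shows "(\<lambda>x. norm (ps_eval c (of_real x) (of_real (s * x ^ m)) -
            (\<Sum>(i,j)\<in>I. c i j * of_real s ^ j * of_real x ^ (i + m * j)))) \<in> O[at_right 0](\<lambda>x. x ^ v)"
proof -
  have fin: "finite I" unfolding I_def using m by (rule finite_weighted_pairs)
  \<comment> \<open>The last entry keeps \<open>s * x ^ m\<close> in the disc of convergence, using
    that \<open>\<rho> \<le> 1\<close> bounds \<open>\<rho> ^ m\<close> by \<rho>; the added 1
    avoids a zero denominator.\<close>
  define \<rho> where "\<rho> = Min {1, r, r / (\<bar>s\<bar> + 1)}"
  have \<rho>: "\<rho> > 0" "\<rho> \<le> 1" "\<rho> \<le> r" "\<rho> \<le> r / (\<bar>s\<bar> + 1)" using r by (auto simp: \<rho>_def)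
  have s\<rho>: "\<bar>s\<bar> * \<rho> ^ m \<le> r"
  proof -
    have "\<rho> ^ m \<le> \<rho> ^ 1" using \<rho> m by (intro power_decreasing) auto
    then have "\<bar>s\<bar> * \<rho> ^ m \<le> (\<bar>s\<bar> + 1) * \<rho>" using \<rho> by (intro mult_mono) auto
    also have "\<dots> \<le> r" using \<rho>(4) by (simp add: field_simps)
    finally show ?thesis .
  qed
  define T where "T = (\<Sum>\<^sub>\<infinity>(i,j)\<in>UNIV - I. norm (c i j) * r ^ (i + j))"
  have "norm (ps_eval c (of_real x) (of_real (s * x ^ m)) -
            (\<Sum>(i,j)\<in>I. c i j * of_real s ^ j * of_real x ^ (i + m * j))) \<le> (x / \<rho>) ^ v * T"
    if x: "0 < x" "x < \<rho>" for x
  proof (rule norm_infsum_le)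
    have "\<bar>s\<bar> * x ^ m \<le> \<bar>s\<bar> * \<rho> ^ m" using x by (intro mult_left_mono power_mono) auto
    then have sx: "norm (complex_of_real (s * x ^ m)) \<le> r" using s\<rho> x by (simp add: norm_mult abs_mult norm_power)
    have "((\<lambda>(i,j). c i j * of_real x ^ i * of_real (s * x ^ m) ^ j) has_sum ps_eval c (of_real x) (of_real (s * x ^ m))) UNIV"
      using x \<rho>(3) by (intro ps_eval_has_sum[OF sm _ sx]) auto
    also have "(\<lambda>(i,j). c i j * of_real x ^ i * of_real (s * x ^ m) ^ j) =
       (\<lambda>(i,j). c i j * of_real s ^ j * of_real x ^ (i + m * j))"
      by (auto simp: fun_eq_iff power_mult_distrib power_add power_mult)
    finally show "((\<lambda>(i,j). c i j * of_real s ^ j * of_real x ^ (i + m * j)) has_sum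
       (ps_eval c (of_real x) (of_real (s * x ^ m)) - (\<Sum>(i,j)\<in>I. c i j * of_real s ^ j * of_real x ^ (i + m * j)))) (UNIV - I)"
      using fin by (intro has_sum_Diff has_sum_finite) auto
    have "(\<lambda>(i,j). norm (c i j) * r ^ (i + j)) summable_on UNIV - I"
      using sm by (rule summable_on_subset) auto
    then show "((\<lambda>p. (x / \<rho>) ^ v * (case p of (i,j) \<Rightarrow> norm (c i j) * r ^ (i + j))) has_sum ((x / \<rho>) ^ v * T)) (UNIV - I)"
      unfolding T_def by (intro has_sum_cmult_right has_sum_infsum)
    fix p assume p: "p \<in> UNIV - I"
    obtain i j where ij: "p = (i, j)" by (cases p)
    have v: "v \<le> i + m * j" using p by (auto simp: I_def ij)
    have "norm (c i j * of_real s ^ j * of_real x ^ (i + m * j)) =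
       norm (c i j) * ((x / \<rho>) ^ (i + m * j) * (\<rho> ^ i * (\<bar>s\<bar> * \<rho> ^ m) ^ j))"
      using x \<rho>(1) by (simp add: norm_mult norm_power power_divide power_add power_mult power_mult_distrib)
    also have "\<dots> \<le> norm (c i j) * ((x / \<rho>) ^ v * (r ^ i * r ^ j))"
      using x \<rho> s\<rho> v by (intro mult_left_mono mult_mono power_mono power_decreasing) auto
    finally show "norm (case p of (i,j) \<Rightarrow> c i j * of_real s ^ j * of_real x ^ (i + m * j)) \<le>
       (x / \<rho>) ^ v * (case p of (i,j) \<Rightarrow> norm (c i j) * r ^ (i + j))"
      by (simp add: ij power_add mult_ac)
  qed
  then have bd: "norm (ps_eval c (of_real x) (of_real (s * x ^ m)) -
            (\<Sum>(i,j)\<in>I. c i j * of_real s ^ j * of_real x ^ (i + m * j))) \<le> T / \<rho> ^ v * x ^ v"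
    if "0 < x" "x < \<rho>" for x using that by (simp add: power_divide mult_ac)
  have "\<forall>\<^sub>F x::real in at_right 0. 0 < x \<and> x < \<rho>"
    using eventually_at_right_real[OF \<rho>(1)] by (auto elim: eventually_mono)
  then have "\<forall>\<^sub>F x in at_right 0. norm (norm (ps_eval c (of_real x) (of_real (s * x ^ m)) -
      (\<Sum>(i,j)\<in>I. c i j * of_real s ^ j * of_real x ^ (i + m * j)))) \<le> T / \<rho> ^ v * norm (x ^ v)"
    by eventually_elim (use bd in simp)
  then show ?thesis by (rule bigoI)
qed

lemma eventually_curve:
  fixes g :: "real \<Rightarrow> real"
  assumes "\<forall>\<^sub>F z in nhds 0. Pr z" "(g \<longlongrightarrow> 0) (at_right 0)"
  shows "\<forall>\<^sub>F x in at_right 0. Pr (complex_of_real x, complex_of_real (g x))"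
proof -
  have "((\<lambda>x. (complex_of_real x, complex_of_real (g x))) \<longlongrightarrow> (of_real 0, of_real 0)) (at_right 0)"
    by (intro tendsto_intros assms(2))
  then have "filterlim (\<lambda>x. (complex_of_real x, complex_of_real (g x))) (nhds 0) (at_right 0)"
    by (simp add: zero_prod_def)
  from eventually_compose_filterlim[OF assms(1) this] show ?thesis .
qed

text \<open>The coefficient of \<open>x\<^sup>n\<close> in \<open>f(x, s x\<^sup>m)\<close> is a polynomial in \<open>s\<close>; if it vanishes for
  infinitely many \<open>s\<close>, it vanishes at \<open>s = 0\<close>.\<close>
lemma germ2_bigo_axis:
  assumes f: "germ2 f" and m: "m > 0" and S: "infinite S"
    and bo: "\<And>s. s \<in> S \<Longrightarrow> (\<lambda>x. norm (f (of_real x, of_real (s * x ^ m)))) \<in> O[at_right 0](\<lambda>x. x ^ v)"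
  shows "(\<lambda>x. norm (f (complex_of_real x, 0))) \<in> O[at_right 0](\<lambda>x. x ^ v)"
proof -
  obtain c where c: "conv_ps c" "\<forall>\<^sub>F z in nhds 0. f z = ps_eval c (fst z) (snd z)"
    using f germ2_iff_ps_eval by blast
  obtain r where r: "r > 0" and sm: "(\<lambda>(i,j). norm (c i j) * r ^ (i + j)) summable_on UNIV"
    using c(1) unfolding conv_ps_def by blast
  have f_eq: "\<forall>\<^sub>F x in at_right 0. f (of_real x, of_real (s * x ^ m)) = ps_eval c (of_real x) (of_real (s * x ^ m))" for s :: real
  proof -
    have "((\<lambda>x. s * x ^ m) \<longlongrightarrow> s * 0 ^ m) (at_right 0)" by (intro tendsto_intros)
    then have "((\<lambda>x. s * x ^ m) \<longlongrightarrow> 0) (at_right 0)" using m by (simp add: power_0_left)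
    from eventually_curve[OF c(2) this] show ?thesis by simp
  qed
  define I where "I = {(i,j). i + m * j < v}"
  have fin: "finite I" unfolding I_def using m by (rule finite_weighted_pairs)
  \<comment> \<open>The Taylor polynomial along the curve, cut off below degree v. Each of its
    coefficients is a polynomial in s.\<close>
  define A where "A s = (\<Sum>(i,j)\<in>I. monom (c i j * complex_of_real s ^ j) (i + m * j))" for s
  have polyA: "poly (A s) x = (\<Sum>(i,j)\<in>I. c i j * of_real s ^ j * x ^ (i + m * j))" for s x
    by (simp add: A_def poly_sum case_prod_unfold poly_monom)
  have trunc: "(\<lambda>x. norm (f (of_real x, of_real (s * x ^ m)) - poly (A s) (of_real x))) \<in> O[at_right 0](\<lambda>x. x ^ v)" for s
  proof -
    have "(\<lambda>x. norm (ps_eval c (of_real x) (of_real (s * x ^ m)) - poly (A s) (of_real x))) \<in> O[at_right 0](\<lambda>x. x ^ v)"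
      using ps_eval_curve_truncation[OF r sm m, of s v] by (simp add: polyA I_def)
    then show ?thesis
      by (rule landau_o.big.ev_eq_trans2[rotated]) (use f_eq[of s] in \<open>auto elim: eventually_mono\<close>)
  qed
  have A0: "A s = 0" if s: "s \<in> S" for s
  proof (rule ccontr)
    assume nz: "A s \<noteq> 0"
    \<comment> \<open>A nonzero polynomial of degree below v also has order below v at 0, which the
      bound excludes.\<close>
    have "coeff (A s) n = 0" if "n \<ge> v" for n
      using that by (auto simp: A_def coeff_sum case_prod_unfold I_def intro!: sum.neutral)
    then have "\<not> degree (A s) \<ge> v" using nz by (metis leading_coeff_0_iff)
    then have deg: "order 0 (A s) < v" using order_degree[OF nz, of 0] by simp
    have "(\<lambda>x. norm (poly (A s) (of_real x))) \<in>
       O[at_right 0](\<lambda>x. norm (f (of_real x, of_real (s * x ^ m))) + norm (f (of_real x, of_real (s * x ^ m)) - poly (A s) (of_real x)))"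
    proof (intro bigoI[of _ 1] always_eventually allI)
      have tri: "norm a \<le> norm b + norm (b - a)" for a b :: complex
        by (metis norm_minus_commute norm_triangle_sub)
      show "norm (norm (poly (A s) (of_real x))) \<le> 1 * norm (norm (f (of_real x, of_real (s * x ^ m))) +
          norm (f (of_real x, of_real (s * x ^ m)) - poly (A s) (of_real x)))" for x
        using tri[of "poly (A s) (of_real x)" "f (of_real x, of_real (s * x ^ m))"] by simp
    qed
    also have "(\<lambda>x. norm (f (of_real x, of_real (s * x ^ m))) + norm (f (of_real x, of_real (s * x ^ m)) - poly (A s) (of_real x)))
        \<in> O[at_right 0](\<lambda>x. x ^ v)"
      by (intro sum_in_bigo bo[OF s] trunc)
    finally have "(\<lambda>x. norm (poly (A s) (complex_of_real x))) \<in> O[at_right 0](\<lambda>x. x ^ v)" .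
    moreover have "(\<lambda>x. x ^ order 0 (A s)) \<in> O[at_right 0](\<lambda>x. norm (poly (A s) (complex_of_real x)))"
      using poly_bigtheta_order[OF nz] by (simp add: bigtheta_def bigomega_iff_bigo)
    ultimately have "(\<lambda>x::real. x ^ order 0 (A s)) \<in> O[at_right 0](\<lambda>x. x ^ v)"
      using landau_o.big_trans by blast
    then show False using power_bigo_at_right_0D deg by fastforce
  qed
  have "c n 0 = 0" if n: "n < v" for n
  proof -
    \<comment> \<open>The coefficient of degree n in \<open>A s\<close>, as a polynomial in s; its
      constant term is the only contribution with j = 0, namely \<open>c n 0\<close>.\<close>
    define B where "B = (\<Sum>(i,j)\<in>I. if i + m * j = n then monom (c i j) j else 0)"
    have "poly B (of_real s) = coeff (A s) n" for s
      unfolding B_def A_def poly_sum coeff_sum by (intro sum.cong) (auto simp: poly_monom)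
    then have "complex_of_real ` S \<subseteq> {z. poly B z = 0}" using A0 by auto
    moreover have "infinite (complex_of_real ` S)" using S by (subst finite_image_iff) (auto simp: inj_on_def)
    ultimately have "B = 0" using poly_roots_finite[of B] finite_subset by blast
    then have "coeff B 0 = 0" by simp
    then have "0 = (\<Sum>p\<in>I. coeff (case p of (i,j) \<Rightarrow> if i + m * j = n then monom (c i j) j else 0) 0)"
      unfolding B_def coeff_sum by (rule sym)
    also have "\<dots> = (\<Sum>p\<in>I. if p = (n, 0) then c n 0 else 0)"
      by (intro sum.cong) (auto split: if_splits)
    also have "\<dots> = c n 0" using fin n by (simp add: I_def)
    finally show ?thesis by simp
  qed
  then have "A 0 = 0" unfolding A_def by (intro sum.neutral) (auto simp: I_def power_0_left)
  then show ?thesis using trunc[of 0] by simp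
qed

section \<open>Products of ideals\<close>

lemma poly_map_poly_of_real:
  "poly (map_poly of_real p) (of_real x :: 'a :: {real_algebra_1, comm_semiring_0}) = of_real (poly p x)"
  by (induction p) (auto simp: map_poly_pCons)

text \<open>T is an arbitrary index set and not an initial segment, because the induction removes
  the index of largest exponent, wherever it lies.\<close>

definition ideal_gen ::
  "(nat \<Rightarrow> real poly) \<Rightarrow> (nat \<Rightarrow> nat) \<Rightarrow> nat set \<Rightarrow> nat set \<Rightarrow> complex \<times> complex \<Rightarrow> complex" where
  "ideal_gen q m T S z =
     (\<Prod>j\<in>T. if j \<in> S then snd z + poly (map_poly of_real (q j)) (fst z) else fst z ^ m j)"

definition in_ideal ::
  "(nat \<Rightarrow> real poly) \<Rightarrow> (nat \<Rightarrow> nat) \<Rightarrow> nat set \<Rightarrow> (complex \<times> complex \<Rightarrow> complex) \<Rightarrow> bool" where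
  "in_ideal q m T f \<longleftrightarrow> (\<exists>h. (\<forall>S. germ2 (h S)) \<and>
     (\<forall>\<^sub>F z in nhds 0. f z = (\<Sum>S\<in>Pow T. h S z * ideal_gen q m T S z)))"

text \<open>The weight \<open>|y + q\<^sub>k(x)| + x\<^bsup>m\<^sub>k\<^esup>\<close> is comparable to the modulus of
  \<open>y + q\<^sub>k(x) + \<i> x\<^bsup>m\<^sub>k\<^esup>\<close>.\<close>
definition curve_bound ::
  "(nat \<Rightarrow> real poly) \<Rightarrow> (nat \<Rightarrow> nat) \<Rightarrow> nat set \<Rightarrow> (complex \<times> complex \<Rightarrow> complex) \<Rightarrow> nat \<Rightarrow> real \<Rightarrow> bool" where
  "curve_bound q m T f j s \<longleftrightarrow>
     (\<lambda>x. norm (f (of_real x, of_real (s * x ^ m j - poly (q j) x))))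
       \<in> O[at_right 0](\<lambda>x. \<Prod>k\<in>T. \<bar>s * x ^ m j - poly (q j) x + poly (q k) x\<bar> + x ^ m k)"

lemma germ2_poly_fst: "germ2 (\<lambda>z. poly p (fst z))"
  by (rule germ2_holomorphic_fst[of _ 1, OF poly_holomorphic_on[OF holomorphic_on_ident]]) simp

lemma germ2_ideal_gen: "germ2 (ideal_gen q m T S)"
proof -
  have "germ2 (\<lambda>z. if j \<in> S then snd z + poly (map_poly of_real (q j)) (fst z) else fst z ^ m j)" for j
    by (cases "j \<in> S") (auto intro: germ2_add germ2_power germ2_poly_fst)
  then show ?thesis unfolding ideal_gen_def[abs_def] by (intro germ2_prod)
qed

lemma in_ideal_add:
  assumes "in_ideal q m T f" "in_ideal q m T g"
  shows "in_ideal q m T (\<lambda>z. f z + g z)"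
proof -
  obtain h where h: "\<And>S. germ2 (h S)" "\<forall>\<^sub>F z in nhds 0. f z = (\<Sum>S\<in>Pow T. h S z * ideal_gen q m T S z)"
    using assms(1) unfolding in_ideal_def by blast
  obtain k where k: "\<And>S. germ2 (k S)" "\<forall>\<^sub>F z in nhds 0. g z = (\<Sum>S\<in>Pow T. k S z * ideal_gen q m T S z)"
    using assms(2) unfolding in_ideal_def by blast
  have "\<forall>\<^sub>F z in nhds 0. f z + g z = (\<Sum>S\<in>Pow T. (h S z + k S z) * ideal_gen q m T S z)"
    using h(2) k(2) by eventually_elim (simp add: distrib_right sum.distrib)
  then show ?thesis unfolding in_ideal_def
    using h(1) k(1) by (intro exI[of _ "\<lambda>S z. h S z + k S z"]) (auto intro: germ2_add)
qed

lemma in_ideal_mult_gen: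
  assumes "finite T" "S \<subseteq> T" "germ2 a"
  shows "in_ideal q m T (\<lambda>z. a z * ideal_gen q m T S z)"
proof -
  have "a z * ideal_gen q m T S z = (\<Sum>S'\<in>Pow T. (if S' = S then a z else 0) * ideal_gen q m T S' z)" for z
  proof -
    have "(\<Sum>S'\<in>Pow T. (if S' = S then a z else 0) * ideal_gen q m T S' z)
        = (\<Sum>S'\<in>Pow T. if S' = S then a z * ideal_gen q m T S z else 0)"
      by (intro sum.cong) auto
    then show ?thesis using assms(1,2) by simp
  qed
  moreover have "germ2 (\<lambda>z. if S' = S then a z else 0)" for S'
    using assms(3) by (cases "S' = S") auto
  ultimately show ?thesis unfolding in_ideal_def
    by (intro exI[of _ "\<lambda>S' z. if S' = S then a z else 0"]) auto
qed

text \<open>The generators of the larger product that choose the linear factor at j are this factor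
  times the generators of the smaller product; subsets without j receive the coefficient 0.\<close>

lemma in_ideal_mult_linear:
  assumes T: "finite T" "j \<notin> T" and f: "in_ideal q m T f"
  shows "in_ideal q m (insert j T) (\<lambda>z. (snd z + poly (map_poly of_real (q j)) (fst z)) * f z)"
proof -
  obtain h where h: "\<And>S. germ2 (h S)" "\<forall>\<^sub>F z in nhds 0. f z = (\<Sum>S\<in>Pow T. h S z * ideal_gen q m T S z)"
    using f unfolding in_ideal_def by blast
  define h' where "h' S z = (if j \<in> S then h (S - {j}) z else 0)" for S z
  have h': "germ2 (h' S)" for S unfolding h'_def[abs_def] using h(1) by (cases "j \<in> S") auto
  have "(\<Sum>S\<in>Pow (insert j T). h' S z * ideal_gen q m (insert j T) S z)
     = (snd z + poly (map_poly of_real (q j)) (fst z)) * (\<Sum>S\<in>Pow T. h S z * ideal_gen q m T S z)" for z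
  proof -
    have disj: "Pow T \<inter> insert j ` Pow T = {}" using T(2) by auto
    have inj: "inj_on (insert j) (Pow T)"
      by (rule inj_on_inverseI[of _ "\<lambda>S. S - {j}"]) (use T(2) in auto)
    have "(\<Sum>S\<in>Pow (insert j T). h' S z * ideal_gen q m (insert j T) S z)
       = (\<Sum>S\<in>Pow T. h' S z * ideal_gen q m (insert j T) S z)
         + (\<Sum>S\<in>insert j ` Pow T. h' S z * ideal_gen q m (insert j T) S z)"
      unfolding Pow_insert using T(1) disj by (intro sum.union_disjoint) auto
    also have "(\<Sum>S\<in>Pow T. h' S z * ideal_gen q m (insert j T) S z) = 0"
      using T(2) by (intro sum.neutral) (auto simp: h'_def)
    also have "(\<Sum>S\<in>insert j ` Pow T. h' S z * ideal_gen q m (insert j T) S z)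
       = (\<Sum>S\<in>Pow T. h' (insert j S) z * ideal_gen q m (insert j T) (insert j S) z)"
      by (simp add: sum.reindex[OF inj])
    also have "\<dots> = (\<Sum>S\<in>Pow T. (snd z + poly (map_poly of_real (q j)) (fst z)) * (h S z * ideal_gen q m T S z))"
    proof (intro sum.cong refl)
      fix S assume "S \<in> Pow T"
      then have "insert j S - {j} = S" using T(2) by auto
      moreover have "ideal_gen q m (insert j T) (insert j S) z
          = (snd z + poly (map_poly of_real (q j)) (fst z)) * ideal_gen q m T S z"
      proof -
        have "(\<Prod>k\<in>T. if k \<in> insert j S then snd z + poly (map_poly of_real (q k)) (fst z) else fst z ^ m k)
            = (\<Prod>k\<in>T. if k \<in> S then snd z + poly (map_poly of_real (q k)) (fst z) else fst z ^ m k)"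
          using T(2) by (intro prod.cong) auto
        then show ?thesis using T by (simp add: ideal_gen_def)
      qed
      ultimately show "h' (insert j S) z * ideal_gen q m (insert j T) (insert j S) z
         = (snd z + poly (map_poly of_real (q j)) (fst z)) * (h S z * ideal_gen q m T S z)"
        by (simp add: h'_def mult_ac)
    qed
    finally show ?thesis by (simp add: sum_distrib_left)
  qed
  then have "\<forall>\<^sub>F z in nhds 0. (snd z + poly (map_poly of_real (q j)) (fst z)) * f z
      = (\<Sum>S\<in>Pow (insert j T). h' S z * ideal_gen q m (insert j T) S z)"
    using h(2) by (auto elim!: eventually_mono)
  then show ?thesis unfolding in_ideal_def using h' by blast
qed

section \<open>Orders of generators and weights on the curves\<close>

lemma curve_tendsto_0:
  fixes s :: real and p :: "real poly"
  assumes "n > 0" "poly p 0 = 0"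
  shows "((\<lambda>x. s * x ^ n - poly p x) \<longlongrightarrow> 0) (at_right 0)"
proof -
  have "((\<lambda>x. s * x ^ n - poly p x) \<longlongrightarrow> s * 0 ^ n - poly p 0) (at_right 0)"
    by (intro tendsto_intros)
  then show ?thesis using assms by (simp add: power_0_left)
qed

lemma norm_ideal_gen_le:
  fixes x y :: real
  assumes "x \<ge> 0"
  shows "norm (ideal_gen q m T S (of_real x, of_real y)) \<le> (\<Prod>k\<in>T. \<bar>y + poly (q k) x\<bar> + x ^ m k)"
  unfolding ideal_gen_def prod_norm[symmetric]
proof (rule prod_mono, intro conjI)
  fix k
  have "norm (complex_of_real y + poly (map_poly of_real (q k)) (of_real x)) = \<bar>y + poly (q k) x\<bar>"
    unfolding poly_map_poly_of_real of_real_add[symmetric] norm_of_real ..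
  then show "norm (if k \<in> S then snd (complex_of_real x, complex_of_real y) + poly (map_poly of_real (q k)) (fst (complex_of_real x, complex_of_real y))
      else fst (complex_of_real x, complex_of_real y) ^ m k) \<le> \<bar>y + poly (q k) x\<bar> + x ^ m k"
    using assms by (auto simp: norm_power)
qed auto

lemma order_0_le:
  assumes "coeff p n \<noteq> 0"
  shows "order 0 p \<le> n"
proof (rule ccontr)
  assume "\<not> order 0 p \<le> n"
  moreover have "p \<noteq> 0" using assms by auto
  ultimately have "monom 1 (Suc n) dvd p" by (simp add: monom_1_dvd_iff)
  then show False using assms by (simp add: monom_1_dvd_iff')
qed

text \<open>The lower half of the two-sided bound keeps the cofactor away from 0. It is thus a unit
  near the origin, which permits division by a restricted generator.\<close>

lemma holomorphic_factor_power_exact: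
  assumes E: "E holomorphic_on ball 0 d" "d > 0"
    and th: "(\<lambda>x. norm (E (complex_of_real x))) \<in> \<Theta>[at_right 0](\<lambda>x. x ^ w)"
  shows "\<exists>U. U holomorphic_on ball 0 d \<and> U 0 \<noteq> 0 \<and> (\<forall>z\<in>ball 0 d. E z = z ^ w * U z)"
proof -
  obtain U where U: "U holomorphic_on ball 0 d" "\<And>z. z \<in> ball 0 d \<Longrightarrow> E z = z ^ w * U z"
    using holomorphic_factor_power[OF E bigthetaD1[OF th]] by blast
  have "(\<lambda>x. x ^ w) \<in> O[at_right 0](\<lambda>x. norm (E (complex_of_real x)))"
    using th by (simp add: bigtheta_def bigomega_iff_bigo)
  then obtain C where C: "\<forall>\<^sub>F x in at_right 0. norm (x ^ w) \<le> C * norm (norm (E (complex_of_real x)))"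
    by (elim landau_o.bigE)
  have "\<forall>\<^sub>F x::real in at_right 0. 0 < x \<and> x < d"
    using eventually_at_right_real[OF E(2)] by (auto elim: eventually_mono)
  with C have ev: "\<forall>\<^sub>F x in at_right 0. 1 \<le> C * norm (U (complex_of_real x))"
  proof eventually_elim
    case (elim x)
    then have "x ^ w * 1 \<le> x ^ w * (C * norm (U (of_real x)))"
      using U(2)[of "of_real x"] by (simp add: norm_mult norm_power mult_ac)
    then show ?case using elim by (simp add: mult_le_cancel_left)
  qed
  have "((\<lambda>x. C * norm (U (complex_of_real x))) \<longlongrightarrow> C * norm (U 0)) (at_right 0)"
    by (intro tendsto_intros holomorphic_tendsto_norm_at_right[OF U(1) E(2)])
  from tendsto_lowerbound[OF this ev] have "1 \<le> C * norm (U 0)" by simp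
  then have "U 0 \<noteq> 0" by auto
  with U show ?thesis by blast
qed

lemma prod_bigtheta_power:
  assumes "\<And>k. k \<in> T \<Longrightarrow> f k \<in> \<Theta>[at_right 0](\<lambda>x::real. x ^ e k)"
  shows "(\<lambda>x. \<Prod>k\<in>T. f k x) \<in> \<Theta>[at_right 0](\<lambda>x. x ^ (\<Sum>k\<in>T. e k))"
  using assms
proof (induction T rule: infinite_finite_induct)
  case (insert k T)
  then have "(\<lambda>x. f k x * (\<Prod>k\<in>T. f k x)) \<in> \<Theta>[at_right 0](\<lambda>x. x ^ e k * x ^ (\<Sum>k\<in>T. e k))"
    by (intro landau_theta.mult) auto
  then show ?case using insert.hyps by (simp add: power_add)
qed simp_all

text \<open>On the curve \<open>y = -q\<^sub>j(x)\<close> with \<open>m\<^sub>j\<close> maximal, some generator of the remaining product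
  has the least order that the bounds permit for \<open>f\<close>.\<close>
lemma minimal_generator:
  fixes q :: "nat \<Rightarrow> real poly" and m :: "nat \<Rightarrow> nat"
  assumes mx: "\<And>k. k \<in> T \<Longrightarrow> m k \<le> n"
  shows "\<exists>S w. S \<subseteq> T \<and>
     (\<lambda>x. norm (ideal_gen q m T S (of_real x, of_real (- poly p x)))) \<in> \<Theta>[at_right 0](\<lambda>x. x ^ w) \<and>
     (\<forall>s. (\<lambda>x. \<Prod>k\<in>T. \<bar>s * x ^ n - poly p x + poly (q k) x\<bar> + x ^ m k) \<in> O[at_right 0](\<lambda>x. x ^ w))"
proof -
  have "\<forall>k. \<exists>e. (\<lambda>x. \<bar>poly (q k - p) x\<bar> + x ^ m k) \<in> \<Theta>[at_right 0](\<lambda>x. x ^ e) \<and>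
      (e = m k \<or> q k - p \<noteq> 0 \<and> e = order 0 (q k - p))"
    using weight_bigtheta by blast
  then obtain e where e: "\<And>k. (\<lambda>x. \<bar>poly (q k - p) x\<bar> + x ^ m k) \<in> \<Theta>[at_right 0](\<lambda>x. x ^ e k)"
      "\<And>k. e k = m k \<or> q k - p \<noteq> 0 \<and> e k = order 0 (q k - p)" by metis
  \<comment> \<open>The linear factor is chosen exactly where \<open>x ^ m k\<close> fails to attain
    the order \<open>e k\<close> of the weight; there \<open>q k - p\<close> attains it.\<close>
  define S where "S = {k \<in> T. e k \<noteq> m k}"
  define w where "w = (\<Sum>k\<in>T. e k)"
  have "(\<lambda>x. norm (ideal_gen q m T S (of_real x, of_real (- poly p x)))) \<in> \<Theta>[at_right 0](\<lambda>x. x ^ w)"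
    unfolding w_def ideal_gen_def prod_norm[symmetric]
  proof (rule prod_bigtheta_power)
    fix k assume k: "k \<in> T"
    show "(\<lambda>x. norm (if k \<in> S then snd (complex_of_real x, complex_of_real (- poly p x)) +
        poly (map_poly of_real (q k)) (fst (complex_of_real x, complex_of_real (- poly p x)))
        else fst (complex_of_real x, complex_of_real (- poly p x)) ^ m k)) \<in> \<Theta>[at_right 0](\<lambda>x. x ^ e k)"
    proof (cases "k \<in> S")
      case True
      then have nz: "q k - p \<noteq> 0" "e k = order 0 (q k - p)" using e(2)[of k] by (auto simp: S_def)
      have "complex_of_real (- poly p x) + poly (map_poly of_real (q k)) (of_real x) = of_real (poly (q k - p) x)" for x
        unfolding poly_map_poly_of_real by simp
      moreover have "(\<lambda>x. \<bar>poly (q k - p) x\<bar>) \<in> \<Theta>[at_right 0](\<lambda>x. x ^ e k)"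
        using poly_bigtheta_order[OF nz(1)] nz(2) by (simp del: poly_diff)
      ultimately show ?thesis using True by (simp only: fst_conv snd_conv if_True norm_of_real)
    next
      case False
      then have "e k = m k" using k by (auto simp: S_def)
      moreover have "(\<lambda>x::real. \<bar>x\<bar> ^ m k) \<in> \<Theta>[at_right 0](\<lambda>x. x ^ m k)"
        by (intro bigthetaI_cong eventually_mono[OF eventually_at_right_less]) auto
      ultimately show ?thesis using False by (simp add: norm_power)
    qed
  qed
  moreover have "(\<lambda>x. \<Prod>k\<in>T. \<bar>s * x ^ n - poly p x + poly (q k) x\<bar> + x ^ m k) \<in> O[at_right 0](\<lambda>x. x ^ w)" for s
  proof -
    have "(\<lambda>x. \<bar>s * x ^ n - poly p x + poly (q k) x\<bar> + x ^ m k) \<in> O[at_right 0](\<lambda>x. x ^ e k)"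
      if k: "k \<in> T" for k
    proof -
      have "\<forall>\<^sub>F x::real in at_right 0. 0 < x \<and> x < 1"
        using eventually_at_right_real[of 0 1] by (auto elim: eventually_mono)
      then have "\<forall>\<^sub>F x in at_right 0. norm (\<bar>s * x ^ n - poly p x + poly (q k) x\<bar> + x ^ m k)
          \<le> (\<bar>s\<bar> + 1) * norm (\<bar>poly (q k - p) x\<bar> + x ^ m k)"
      proof eventually_elim
        case (elim x)
        have "\<bar>s * x ^ n - poly p x + poly (q k) x\<bar> \<le> \<bar>s\<bar> * x ^ n + \<bar>poly (q k - p) x\<bar>"
          using elim abs_triangle_ineq[of "s * x ^ n" "poly (q k - p) x"] by (simp add: abs_mult algebra_simps)
        \<comment> \<open>Here \<open>m k \<le> n\<close> enters: passing from s = 0 to another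
          curve of the family moves y by a multiple of x^n, which the summand \<open>x ^ m k\<close>
          of the weight absorbs.\<close>
        also have "\<bar>s\<bar> * x ^ n \<le> \<bar>s\<bar> * x ^ m k"
          using elim mx[OF k] by (intro mult_left_mono power_decreasing) auto
        finally have "\<bar>s * x ^ n - poly p x + poly (q k) x\<bar> + x ^ m k
            \<le> (\<bar>s\<bar> + 1) * x ^ m k + 1 * \<bar>poly (q k - p) x\<bar>" by (simp add: algebra_simps)
        also have "1 * \<bar>poly (q k - p) x\<bar> \<le> (\<bar>s\<bar> + 1) * \<bar>poly (q k - p) x\<bar>"
          by (intro mult_right_mono) auto
        finally show ?case using elim by (simp add: algebra_simps)
      qed
      then have "(\<lambda>x. \<bar>s * x ^ n - poly p x + poly (q k) x\<bar> + x ^ m k) \<in> O[at_right 0](\<lambda>x. \<bar>poly (q k - p) x\<bar> + x ^ m k)"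
        by (rule bigoI)
      also note bigthetaD1[OF e(1)[of k]]
      finally show ?thesis .
    qed
    then have "(\<lambda>x. \<Prod>k\<in>T. \<bar>s * x ^ n - poly p x + poly (q k) x\<bar> + x ^ m k) \<in> O[at_right 0](\<lambda>x. \<Prod>k\<in>T. x ^ e k)"
      by (rule landau_o.big_prod)
    then show ?thesis by (simp add: w_def power_sum)
  qed
  ultimately show ?thesis by (intro exI[of _ S] exI[of _ w]) (auto simp: S_def)
qed

text \<open>On the curve the linear factor of index j restricts to the polynomial r. Its coefficient
  of degree \<open>m i\<close> is that of \<open>q j - q i\<close> plus s, so it vanishes only for
  the excluded s. Otherwise r has order at most \<open>m i \<le> m j\<close>, the summand
  \<open>x ^ m j\<close> is absorbed by \<open>\<bar>poly r x\<bar>\<close>, and the weight of index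
  j cancels against the linear factor.\<close>

lemma curve_bound_quotient:
  fixes s :: real
  assumes T: "finite T" "j \<in> T" and mi: "0 < m i" "m i \<le> m j" "poly (q i) 0 = 0"
    and s: "s \<noteq> - coeff (q j - q i) (m i)"
    and cb: "curve_bound q m T f i s"
    and eq: "\<forall>\<^sub>F z in nhds 0. f z = (snd z + poly (map_poly of_real (q j)) (fst z)) * h z"
  shows "curve_bound q m (T - {j}) h i s"
proof -
  define g where "g x = s * x ^ m i - poly (q i) x" for x
  define r where "r = q j - q i + monom s (m i)"
  have r: "poly r x = g x + poly (q j) x" for x by (simp add: r_def g_def poly_monom)
  have cr: "coeff r (m i) \<noteq> 0" using s by (auto simp: r_def)
  then have r0: "r \<noteq> 0" by auto
  have ord: "order 0 r \<le> m j" using order_0_le[OF cr] mi(2) by simp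
  have th: "(\<lambda>x. \<bar>poly r x\<bar>) \<in> \<Theta>[at_right 0](\<lambda>x. x ^ order 0 r)"
    using poly_bigtheta_order[OF r0] by simp
  define W where "W x = (\<Prod>k\<in>T - {j}. \<bar>g x + poly (q k) x\<bar> + x ^ m k)" for x
  have "(\<lambda>x. \<bar>poly r x\<bar> * norm (h (of_real x, of_real (g x)))) \<in> O[at_right 0](\<lambda>x. (\<bar>poly r x\<bar> + x ^ m j) * W x)"
  proof (rule landau_o.big.ev_eq_trans2[rotated])
    show "(\<lambda>x. norm (f (of_real x, of_real (g x)))) \<in> O[at_right 0](\<lambda>x. (\<bar>poly r x\<bar> + x ^ m j) * W x)"
      using cb T unfolding curve_bound_def r W_def g_def by (simp add: prod.remove)
    have "\<forall>\<^sub>F x in at_right 0. f (of_real x, of_real (g x)) =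
        (of_real (g x) + poly (map_poly of_real (q j)) (of_real x)) * h (of_real x, of_real (g x))"
      using eventually_curve[OF eq curve_tendsto_0[OF mi(1,3), of s]] by (simp add: g_def)
    then show "\<forall>\<^sub>F x in at_right 0. \<bar>poly r x\<bar> * norm (h (of_real x, of_real (g x))) = norm (f (of_real x, of_real (g x)))"
    proof eventually_elim
      case (elim x)
      have "complex_of_real (g x) + poly (map_poly of_real (q j)) (of_real x) = of_real (poly r x)"
        unfolding poly_map_poly_of_real r by simp
      then show ?case unfolding elim by (simp add: norm_mult)
    qed
  qed
  also have "(\<lambda>x. (\<bar>poly r x\<bar> + x ^ m j) * W x) \<in> O[at_right 0](\<lambda>x. \<bar>poly r x\<bar> * W x)"
  proof (intro landau_o.big.mult_right sum_in_bigo landau_o.big_refl)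
    have "(\<lambda>x::real. x ^ m j) \<in> O[at_right 0](\<lambda>x. x ^ order 0 r)" by (rule power_bigo_at_right_0[OF ord])
    also have "(\<lambda>x::real. x ^ order 0 r) \<in> O[at_right 0](\<lambda>x. \<bar>poly r x\<bar>)"
      using th by (simp add: bigtheta_def bigomega_iff_bigo)
    finally show "(\<lambda>x::real. x ^ m j) \<in> O[at_right 0](\<lambda>x. \<bar>poly r x\<bar>)" .
  qed
  finally have "(\<lambda>x. \<bar>poly r x\<bar> * norm (h (of_real x, of_real (g x)))) \<in> O[at_right 0](\<lambda>x. \<bar>poly r x\<bar> * W x)" .
  moreover have "\<forall>\<^sub>F x in at_right 0. \<bar>poly r x\<bar> \<noteq> 0"
  proof -
    have "\<forall>\<^sub>F x::real in at_right 0. x ^ order 0 r \<noteq> 0"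
      by (rule eventually_mono[OF eventually_at_right_less]) auto
    then show ?thesis using eventually_nonzero_bigtheta[OF th] by simp
  qed
  ultimately have "(\<lambda>x. norm (h (of_real x, of_real (g x)))) \<in> O[at_right 0](\<lambda>x. W x)"
    by (simp only: landau_o.big.mult_cancel_left[OF bigtheta_refl[of "\<lambda>x. \<bar>poly r x\<bar>"]])
  then show ?thesis unfolding curve_bound_def W_def g_def .
qed

text \<open>The algebraic half, free of integrals: upper bounds for f along sufficiently many curves
  imply membership.\<close>

lemma curve_bound_imp_in_ideal:
  assumes "finite T" "\<And>j. j \<in> T \<Longrightarrow> m j > 0" "\<And>j. j \<in> T \<Longrightarrow> poly (q j) 0 = 0" "germ2 f"
    "\<And>j. j \<in> T \<Longrightarrow> infinite {s. curve_bound q m T f j s}"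
  shows "in_ideal q m T f"
  using assms
proof (induction "card T" arbitrary: T f)
  case 0
  then have "T = {}" by simp
  \<comment> \<open>The empty product is the unit ideal, and f is the coefficient of its generator
    1.\<close>
  then show ?case using 0 unfolding in_ideal_def by (intro exI[of _ "\<lambda>_. f"]) (auto simp: ideal_gen_def)
next
  case (Suc n)
  have T: "finite T" "T \<noteq> {}" using Suc by auto
  have "Max (m ` T) \<in> m ` T" using T by (intro Max_in) auto
  then obtain j where j: "j \<in> T" "m j = Max (m ` T)" by auto
  have mx: "m k \<le> m j" if "k \<in> T" for k using j(2) T(1) that by simp
  define T' where "T' = T - {j}"
  have T': "finite T'" "j \<notin> T'" "insert j T' = T" "card T' = n"
    using Suc.hyps(2) T(1) j(1) by (auto simp: T'_def)
  obtain S w where S: "S \<subseteq> T'"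
    and Sth: "(\<lambda>x. norm (ideal_gen q m T' S (of_real x, of_real (- poly (q j) x)))) \<in> \<Theta>[at_right 0](\<lambda>x. x ^ w)"
    and Sbd: "\<And>s. (\<lambda>x. \<Prod>k\<in>T'. \<bar>s * x ^ m j - poly (q j) x + poly (q k) x\<bar> + x ^ m k) \<in> O[at_right 0](\<lambda>x. x ^ w)"
    using minimal_generator[of T' m "m j" q "q j"] mx by (auto simp: T'_def)
  define v where "v = m j + w"
  define \<gamma> where "\<gamma> = poly (map_poly complex_of_real (q j))"
  have \<gamma>: "\<gamma> holomorphic_on ball 0 1" unfolding \<gamma>_def by (rule poly_holomorphic_on[OF holomorphic_on_ident])
  have \<gamma>r: "\<gamma> (of_real x) = of_real (poly (q j) x)" for x unfolding \<gamma>_def by (rule poly_map_poly_of_real)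
  have \<gamma>0: "\<gamma> 0 = 0" using \<gamma>r[of 0] Suc.prems(3)[OF j(1)] by simp
  have m\<gamma>: "(\<lambda>x. - \<gamma> x) holomorphic_on ball 0 1" by (intro holomorphic_intros \<gamma>)
  have m\<gamma>0: "- \<gamma> 0 = 0" using \<gamma>0 by simp

  have "(\<lambda>x. norm (f (complex_of_real x, - \<gamma> (of_real x)))) \<in> O[at_right 0](\<lambda>x. x ^ v)"
  proof -
    \<comment> \<open>The shear turns the curves y = s x^m - q_j(x) into y = s x^m, so that the case
      s = 0 becomes the x-axis.\<close>
    define F where "F z = f (fst z, snd z + - \<gamma> (fst z))" for z
    have "germ2 F" unfolding F_def by (rule germ2_shear[OF Suc.prems(4) m\<gamma> _ m\<gamma>0]) simp
    moreover have "(\<lambda>x. norm (F (of_real x, of_real (s * x ^ m j)))) \<in> O[at_right 0](\<lambda>x. x ^ v)"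
      if s: "s \<in> {s. curve_bound q m T f j s}" for s
    proof -
      have "(\<lambda>x. norm (F (of_real x, of_real (s * x ^ m j))))
         \<in> O[at_right 0](\<lambda>x. \<Prod>k\<in>T. \<bar>s * x ^ m j - poly (q j) x + poly (q k) x\<bar> + x ^ m k)"
        using s by (simp add: curve_bound_def F_def \<gamma>r)
      \<comment> \<open>On its own curve the weight of index j equals
        \<open>(\<bar>s\<bar> + 1) * x ^ m j\<close> for x > 0; this is the origin of the summand
        \<open>m j\<close> in v.\<close>
      also have "(\<lambda>x. \<Prod>k\<in>T. \<bar>s * x ^ m j - poly (q j) x + poly (q k) x\<bar> + x ^ m k)
        = (\<lambda>x. (\<bar>s * x ^ m j\<bar> + x ^ m j) * (\<Prod>k\<in>T'. \<bar>s * x ^ m j - poly (q j) x + poly (q k) x\<bar> + x ^ m k))"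
        unfolding T'(3)[symmetric] using T'(1,2) by simp
      also have "\<dots> \<in> O[at_right 0](\<lambda>x. x ^ m j * x ^ w)"
        by (intro landau_o.big.mult Sbd sum_in_bigo landau_o.big_refl) simp
      finally show ?thesis by (simp add: v_def power_add)
    qed
    ultimately have "(\<lambda>x. norm (F (complex_of_real x, 0))) \<in> O[at_right 0](\<lambda>x. x ^ v)"
      by (rule germ2_bigo_axis[OF _ Suc.prems(2)[OF j(1)] Suc.prems(5)[OF j(1)]])
    then show ?thesis by (simp add: F_def)
  qed
  note bd = this
  obtain d where d: "d > 0" "(\<lambda>z. f (z, - \<gamma> z)) holomorphic_on ball 0 d"
    using germ2_curve_holomorphic[OF Suc.prems(4) m\<gamma> _ m\<gamma>0] by auto
  obtain H where H: "H holomorphic_on ball 0 d" "\<And>z. z \<in> ball 0 d \<Longrightarrow> f (z, - \<gamma> z) = z ^ v * H z"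
    using holomorphic_factor_power[OF d(2,1) bd] by blast
  obtain d' where d': "d' > 0" "(\<lambda>z. ideal_gen q m T' S (z, - \<gamma> z)) holomorphic_on ball 0 d'"
    using germ2_curve_holomorphic[OF germ2_ideal_gen[of q m T' S] m\<gamma> _ m\<gamma>0] by auto
  have "(\<lambda>x. norm (ideal_gen q m T' S (of_real x, - \<gamma> (of_real x)))) \<in> \<Theta>[at_right 0](\<lambda>x. x ^ w)"
    using Sth by (simp add: \<gamma>r)
  from holomorphic_factor_power_exact[OF d'(2,1) this]
  obtain U where U: "U holomorphic_on ball 0 d'" "U 0 \<noteq> 0"
    "\<And>z. z \<in> ball 0 d' \<Longrightarrow> ideal_gen q m T' S (z, - \<gamma> z) = z ^ w * U z" by blast
  obtain \<delta> where \<delta>: "\<delta> > 0" "\<delta> \<le> d'" "\<And>z. norm z < \<delta> \<Longrightarrow> norm (U z - U 0) < norm (U 0)"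
    using holomorphic_small[OF holomorphic_on_diff[OF U(1) holomorphic_on_const[of "U 0"]] d'(1), of "norm (U 0)"]
      U(2) by auto
  define \<epsilon> where "\<epsilon> = min d \<delta>"
  have \<epsilon>: "\<epsilon> > 0" using d \<delta> by (simp add: \<epsilon>_def)
  have Unz: "U z \<noteq> 0" if "norm z < \<epsilon>" for z using \<delta>(3)[of z] that by (auto simp: \<epsilon>_def)
  \<comment> \<open>The quotient of f by the generator along the curve. The power z^v cancels,
    because the generator over T carries \<open>m j\<close> powers of z beyond the w powers of the
    generator over \<open>T'\<close>.\<close>
  define \<alpha> where "\<alpha> z = H z / U z" for z
  have "\<alpha> holomorphic_on ball 0 \<epsilon>" unfolding \<alpha>_def
    by (intro holomorphic_intros holomorphic_on_subset[OF H(1)] holomorphic_on_subset[OF U(1)])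
       (use \<delta> Unz in \<open>auto simp: \<epsilon>_def\<close>)
  then have g\<alpha>: "germ2 (\<lambda>z. \<alpha> (fst z))" using \<epsilon> by (rule germ2_holomorphic_fst)
  have genT: "ideal_gen q m T S z = fst z ^ m j * ideal_gen q m T' S z" for z
    unfolding T'(3)[symmetric] using T'(1,2) S by (auto simp: ideal_gen_def)
  define f1 where "f1 z = f z - \<alpha> (fst z) * ideal_gen q m T S z" for z
  have gf1: "germ2 f1" unfolding f1_def
    by (intro germ2_diff germ2_mult Suc.prems(4) g\<alpha> germ2_ideal_gen)
  have "f1 (x, - \<gamma> x) = 0" if x: "norm x < \<epsilon>" for x
    using H(2)[of x] U(3)[of x] Unz[OF x] x \<delta>(2) by (auto simp: f1_def genT \<alpha>_def \<epsilon>_def v_def power_add)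
  then have "\<forall>\<^sub>F x in nhds 0. f1 (x, - \<gamma> x) = 0"
    unfolding eventually_nhds_metric using \<epsilon> by auto
  from germ2_divide[OF gf1 \<gamma> _ \<gamma>0 this] obtain h where h: "germ2 h"
    "\<forall>\<^sub>F z in nhds 0. f1 z = (snd z + \<gamma> (fst z)) * h z" by auto
  have "in_ideal q m T' h"
  proof (rule Suc.hyps(1))
    fix i assume i: "i \<in> T'"
    then have iT: "i \<in> T" by (simp add: T'_def)
    \<comment> \<open>Subtracting the multiple of the generator preserves the bounds: every
      generator is at most the product of the weights, and \<alpha> is bounded near 0.\<close>
    have cb: "curve_bound q m T f1 i s" if s: "curve_bound q m T f i s" for s
    proof -
      define g where "g x = s * x ^ m i - poly (q i) x" for x
      have g0: "(g \<longlongrightarrow> 0) (at_right 0)" unfolding g_def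
        by (rule curve_tendsto_0[OF Suc.prems(2,3)[OF iT]])
      obtain B where B: "B \<ge> 0" "\<forall>\<^sub>F z in nhds (0 :: complex \<times> complex). norm (\<alpha> (fst z)) \<le> B"
        using germ2_bounded[OF g\<alpha>] by blast
      have "\<forall>\<^sub>F x in at_right 0. norm (\<alpha> (of_real x)) \<le> B"
        using eventually_curve[OF B(2) g0] by (simp only: fst_conv)
      with eventually_at_right_less[of "0::real"]
      have "\<forall>\<^sub>F x in at_right 0. norm (norm (\<alpha> (of_real x) * ideal_gen q m T S (of_real x, of_real (g x))))
          \<le> B * norm (\<Prod>k\<in>T. \<bar>g x + poly (q k) x\<bar> + x ^ m k)"
      proof eventually_elim
        case (elim x)
        then have "norm (ideal_gen q m T S (of_real x, of_real (g x))) \<le> norm (\<Prod>k\<in>T. \<bar>g x + poly (q k) x\<bar> + x ^ m k)"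
          using order_trans[OF norm_ideal_gen_le[of x q m T S "g x"] abs_ge_self] by simp
        then show ?case using elim B(1) by (simp add: norm_mult mult_mono)
      qed
      then have a: "(\<lambda>x. norm (\<alpha> (of_real x) * ideal_gen q m T S (of_real x, of_real (g x)))) \<in>
         O[at_right 0](\<lambda>x. \<Prod>k\<in>T. \<bar>g x + poly (q k) x\<bar> + x ^ m k)"
        by (rule bigoI)
      have "(\<lambda>x. norm (f1 (of_real x, of_real (g x)))) \<in> O[at_right 0](\<lambda>x.
         norm (f (of_real x, of_real (g x))) + norm (\<alpha> (of_real x) * ideal_gen q m T S (of_real x, of_real (g x))))"
        by (intro bigoI[of _ 1] always_eventually allI) (auto simp: f1_def intro: order_trans[OF norm_triangle_ineq4])
      also have "\<dots> \<subseteq> O[at_right 0](\<lambda>x. \<Prod>k\<in>T. \<bar>g x + poly (q k) x\<bar> + x ^ m k)"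
        using s a by (intro landau_o.big_subsetI sum_in_bigo) (auto simp: curve_bound_def g_def)
      finally show ?thesis by (simp add: curve_bound_def g_def)
    qed
    \<comment> \<open>One value of s is given up on each remaining curve, the one at which the
      linear factor may vanish to too high an order.\<close>
    have "{s. curve_bound q m T f i s} - {- coeff (q j - q i) (m i)} \<subseteq> {s. curve_bound q m T' h i s}"
    proof
      fix s assume s: "s \<in> {s. curve_bound q m T f i s} - {- coeff (q j - q i) (m i)}"
      have "curve_bound q m (T - {j}) h i s"
      proof (rule curve_bound_quotient[OF T(1) j(1) _ mx[OF iT]])
        show "curve_bound q m T f1 i s" using cb s by simp
      qed (use s h(2) Suc.prems(2,3) iT in \<open>auto simp: \<gamma>_def\<close>)
      then show "s \<in> {s. curve_bound q m T' h i s}" by (simp add: T'_def)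
    qed
    then show "infinite {s. curve_bound q m T' h i s}"
      using Suc.prems(5)[OF iT] finite_subset by (metis finite_Diff_insert Diff_empty)
  qed (use T' Suc.prems h(1) in \<open>auto simp: T'_def\<close>)
  from in_ideal_mult_linear[OF T'(1,2) this]
  have "in_ideal q m T (\<lambda>z. (snd z + \<gamma> (fst z)) * h z)" by (simp add: T'(3) \<gamma>_def)
  moreover have "in_ideal q m T (\<lambda>z. \<alpha> (fst z) * ideal_gen q m T S z)"
    using S by (intro in_ideal_mult_gen T(1) g\<alpha>) (auto simp: T'_def)
  ultimately have "in_ideal q m T (\<lambda>z. (snd z + \<gamma> (fst z)) * h z + \<alpha> (fst z) * ideal_gen q m T S z)"
    by (rule in_ideal_add)
  then obtain k where k: "\<And>S. germ2 (k S)" "\<forall>\<^sub>F z in nhds 0. (snd z + \<gamma> (fst z)) * h z + \<alpha> (fst z) * ideal_gen q m T S z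
      = (\<Sum>S\<in>Pow T. k S z * ideal_gen q m T S z)" unfolding in_ideal_def by blast
  from h(2) k(2) have "\<forall>\<^sub>F z in nhds 0. f z = (\<Sum>S\<in>Pow T. k S z * ideal_gen q m T S z)"
    by eventually_elim (simp add: f1_def algebra_simps)
  then show ?case unfolding in_ideal_def using k(1) by blast
qed

section \<open>Integrability along curves\<close>

lemma nn_integral_inverse_at_0:
  assumes "\<delta> > 0"
  shows "(\<integral>\<^sup>+x. indicator {0<..<\<delta>} x * ennreal (1 / x) \<partial>lborel) = \<infinity>"
proof (rule ccontr)
  assume "(\<integral>\<^sup>+x. indicator {0<..<\<delta>} x * ennreal (1 / x) \<partial>lborel) \<noteq> \<infinity>"
  then obtain I where I: "(\<integral>\<^sup>+x. indicator {0<..<\<delta>} x * ennreal (1 / x) \<partial>lborel) = ennreal I" "I \<ge> 0"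
    by (cases "\<integral>\<^sup>+x. indicator {0<..<\<delta>} x * ennreal (1 / x) \<partial>lborel" rule: ennreal_cases) auto
  define b where "b = \<delta> / 2"
  \<comment> \<open>Chosen so that the integral of 1/x over [a, b], which is ln b - ln a, equals I +
    1.\<close>
  define a where "a = b * exp (- (I + 1))"
  have b: "0 < b" "b < \<delta>" using assms by (auto simp: b_def)
  have a: "0 < a" "a \<le> b" using b I by (auto simp: a_def)
  have "(\<integral>\<^sup>+x. ennreal (1 / x) * indicator {a..b} x \<partial>lborel) = ennreal (ln b - ln a)"
  proof (rule nn_integral_FTC_Icc)
    show "(ln has_real_derivative 1 / x) (at x)" if "x \<in> {a..b}" for x
      using that a by (auto intro!: derivative_eq_intros)
  qed (use a in auto)
  also have "ln b - ln a = I + 1" using b by (simp add: a_def ln_mult)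
  finally have "ennreal (I + 1) = (\<integral>\<^sup>+x. ennreal (1 / x) * indicator {a..b} x \<partial>lborel)" by simp
  also have "\<dots> \<le> (\<integral>\<^sup>+x. indicator {0<..<\<delta>} x * ennreal (1 / x) \<partial>lborel)"
    by (intro nn_integral_mono) (use a b in \<open>auto split: split_indicator\<close>)
  finally show False using I by (simp add: ennreal_le_iff)
qed

text \<open>For fixed x > 0 the substitution y = \<gamma>(x) + s x^m is affine in s with Jacobian
  x^m, so Tonelli's theorem bounds the double integral over s and x by the integral of H. A
  nonnegative function of s with finite integral is finite almost everywhere.\<close>

lemma AE_nn_integral_curve_finite:
  fixes H :: "real \<times> real \<Rightarrow> ennreal" and \<gamma> :: "real \<Rightarrow> real"
  assumes H [measurable]: "H \<in> borel_measurable borel" and \<gamma> [measurable]: "\<gamma> \<in> borel_measurable borel"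
    and fin: "(\<integral>\<^sup>+z. H z \<partial>lborel) < \<infinity>"
  shows "AE s in lborel. (\<integral>\<^sup>+x. indicator {0<..} x * ennreal (x ^ m) * H (x, \<gamma> x + s * x ^ m) \<partial>lborel) < \<infinity>"
proof -
  have "(\<integral>\<^sup>+s. \<integral>\<^sup>+x. indicator {0<..} x * ennreal (x ^ m) * H (x, \<gamma> x + s * x ^ m) \<partial>lborel \<partial>lborel)
      = (\<integral>\<^sup>+x. \<integral>\<^sup>+s. indicator {0<..} x * ennreal (x ^ m) * H (x, \<gamma> x + s * x ^ m) \<partial>lborel \<partial>lborel)"
    by (rule lborel_pair.Fubini') measurable
  also have "\<dots> \<le> (\<integral>\<^sup>+x. \<integral>\<^sup>+y. H (x, y) \<partial>lborel \<partial>lborel)"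
  proof (rule nn_integral_mono)
    fix x :: real
    show "(\<integral>\<^sup>+s. indicator {0<..} x * ennreal (x ^ m) * H (x, \<gamma> x + s * x ^ m) \<partial>lborel) \<le> (\<integral>\<^sup>+y. H (x, y) \<partial>lborel)"
    proof (cases "x > 0")
      case True
      have "(\<integral>\<^sup>+y. H (x, y) \<partial>lborel) = ennreal \<bar>x ^ m\<bar> * (\<integral>\<^sup>+s. H (x, \<gamma> x + x ^ m * s) \<partial>lborel)"
        using True by (intro nn_integral_real_affine) auto
      also have "\<dots> = (\<integral>\<^sup>+s. indicator {0<..} x * ennreal (x ^ m) * H (x, \<gamma> x + s * x ^ m) \<partial>lborel)"
        using True by (subst nn_integral_cmult[symmetric]) (auto simp: mult_ac)
      finally show ?thesis by simp
    qed simp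
  qed
  also have "\<dots> = (\<integral>\<^sup>+z. H z \<partial>(lborel \<Otimes>\<^sub>M lborel))"
    by (rule lborel.nn_integral_fst) (simp add: lborel_prod)
  also have "\<dots> < \<infinity>" using fin by (simp add: lborel_prod)
  finally have "(\<integral>\<^sup>+s. \<integral>\<^sup>+x. indicator {0<..} x * ennreal (x ^ m) * H (x, \<gamma> x + s * x ^ m) \<partial>lborel \<partial>lborel) \<noteq> \<infinity>"
    by simp
  from nn_integral_PInf_AE[OF _ this] show ?thesis
    by (simp add: top.not_eq_extremum)
qed

text \<open>In general a failing upper bound gives only a sequence of bad points. For holomorphic F
  it gives a lower bound on a whole interval: if the exponent n is admissible and n + 1 is not, the
  cofactor of x^n cannot vanish at 0, since otherwise one more power could be split off.\<close>

lemma holomorphic_bigo_power_maximal: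
  assumes F: "F holomorphic_on ball 0 d" "d > 0"
    and no: "(\<lambda>x. norm (F (complex_of_real x))) \<notin> O[at_right 0](\<lambda>x. x ^ v)"
  shows "\<exists>n<v. \<exists>c>0. \<forall>\<^sub>F x in at_right 0. c * x ^ n \<le> norm (F (of_real x))"
proof -
  note lim = holomorphic_tendsto_norm_at_right[OF _ F(2)]
  have bnd: "(\<lambda>x. norm (G (complex_of_real x))) \<in> O[at_right 0](\<lambda>_. 1)"
    if "G holomorphic_on ball 0 d" for G
    using lim[OF that] by (intro bigoI_tendsto[of _ _ "norm (G 0)"]) auto
  have ev: "\<forall>\<^sub>F x::real in at_right 0. 0 < x \<and> x < d"
    using eventually_at_right_real[OF F(2)] by (auto elim: eventually_mono)
  define A where "A n \<longleftrightarrow> (\<lambda>x. norm (F (complex_of_real x))) \<in> O[at_right 0](\<lambda>x. x ^ n)" for n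
  have "\<exists>n<v. A n \<and> \<not> A (Suc n)"
  proof (rule ccontr)
    assume "\<not> (\<exists>n<v. A n \<and> \<not> A (Suc n))"
    then have step: "\<And>n. n < v \<Longrightarrow> A n \<Longrightarrow> A (Suc n)" by blast
    have "n \<le> v \<Longrightarrow> A n" for n
    proof (induction n)
      case 0 then show ?case using bnd[OF F(1)] by (simp add: A_def)
    qed (use step in auto)
    then show False using no by (simp add: A_def)
  qed
  then obtain n where n: "n < v" "A n" "\<not> A (Suc n)" by blast
  obtain H where H: "H holomorphic_on ball 0 d" "\<And>z. z \<in> ball 0 d \<Longrightarrow> F z = z ^ n * H z"
    using holomorphic_factor_power[OF F] n(2) unfolding A_def by blast
  have "H 0 \<noteq> 0"
  proof
    assume H0: "H 0 = 0"
    define K where "K z = (if z = 0 then deriv H 0 else (H z - H 0) / (z - 0))" for z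
    have K: "K holomorphic_on ball 0 d" unfolding K_def by (rule pole_lemma_open[OF H(1)]) simp
    have "(\<lambda>x. x ^ Suc n * norm (K (complex_of_real x))) \<in> O[at_right 0](\<lambda>x. x ^ Suc n * 1)"
      by (intro landau_o.big.mult landau_o.big_refl bnd K)
    moreover have "\<forall>\<^sub>F x in at_right 0. norm (F (complex_of_real x)) = x ^ Suc n * norm (K (of_real x))"
      using ev
    proof eventually_elim
      case (elim x)
      then show ?case using H(2)[of "of_real x"] H0 by (auto simp: K_def norm_mult norm_power norm_divide)
    qed
    ultimately have "A (Suc n)" unfolding A_def using landau_o.big.in_cong by fastforce
    with n show False by blast
  qed
  then have "\<forall>\<^sub>F x in at_right 0. norm (H 0) / 2 < norm (H (complex_of_real x))"
    by (intro order_tendstoD(1)[OF lim[OF H(1)]]) simp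
  with ev have "\<forall>\<^sub>F x in at_right 0. norm (H 0) / 2 * x ^ n \<le> norm (F (of_real x))"
  proof eventually_elim
    case (elim x)
    have "norm (F (of_real x)) = x ^ n * norm (H (of_real x))"
      using H(2)[of "of_real x"] elim by (simp add: norm_mult norm_power)
    then show ?case using elim mult_left_mono[of "norm (H 0) / 2" "norm (H (of_real x))" "x ^ n"] by (simp add: mult.commute)
  qed
  then show ?thesis using n(1) \<open>H 0 \<noteq> 0\<close>
    by (intro exI[of _ n] conjI exI[of _ "norm (H 0) / 2"]) auto
qed

text \<open>A failure of the bound means \<open>|F| \<ge> c x\<^bsup>v-1\<^esup>\<close>, and then the integrand dominates a multiple
  of \<open>x\<^bsup>m-(K+1)\<^esup> \<ge> 1/x\<close>.\<close>
lemma bigo_of_nn_integral_finite: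
  fixes K m v :: nat
  assumes F: "F holomorphic_on ball 0 d" "d > 0" and mK: "m \<le> K" and C: "C > 0" and \<delta>: "\<delta> > 0"
    and G: "\<And>x. 0 < x \<Longrightarrow> x < \<delta> \<Longrightarrow> norm (F (of_real x)) / (C * x ^ v) \<le> G x"
    and fin: "(\<integral>\<^sup>+x. indicator {0<..} x * ennreal (x ^ m) * ennreal (indicator {0<..<\<delta>} x * G x powr (real K + 1)) \<partial>lborel) < \<infinity>"
  shows "(\<lambda>x. norm (F (complex_of_real x))) \<in> O[at_right 0](\<lambda>x. x ^ v)"
proof (rule ccontr)
  assume "\<not> ?thesis"
  from holomorphic_bigo_power_maximal[OF F this] obtain n c where n: "n < v" and c: "c > 0"
    and ev: "\<forall>\<^sub>F x in at_right 0. c * x ^ n \<le> norm (F (complex_of_real x))" by blast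
  obtain b where b: "b > 0" "\<And>x. 0 < x \<Longrightarrow> x < b \<Longrightarrow> c * x ^ n \<le> norm (F (complex_of_real x))"
    using ev unfolding eventually_at_right_field by auto
  define a where "a = Min {b, \<delta>, 1}"
  have a: "a > 0" "a \<le> b" "a \<le> \<delta>" "a \<le> 1" using b \<delta> by (auto simp: a_def)
  define k where "k = (c / C) powr (real K + 1)"
  have k: "k > 0" using c C by (simp add: k_def)
  have key: "k * (1 / x) \<le> x ^ m * G x powr (real K + 1)" if x: "0 < x" "x < a" for x
  proof -
    \<comment> \<open>The order falls short by a whole power, so \<open>G x\<close> is at least a
      multiple of 1/x. For m = K a fractional shortfall would leave the integral convergent.\<close>
    have "x ^ v \<le> x ^ Suc n" using x a n by (intro power_decreasing) auto
    then have "c * x ^ n / (C * x ^ Suc n) \<le> c * x ^ n / (C * x ^ v)"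
      using x c C by (intro divide_left_mono mult_left_mono) auto
    also have "\<dots> \<le> norm (F (of_real x)) / (C * x ^ v)"
      using b(2)[of x] x a C by (intro divide_right_mono) auto
    also have "\<dots> \<le> G x" using G x a by auto
    finally have "c / C * (1 / x) \<le> G x" using x by simp
    then have "(c / C * (1 / x)) powr (real K + 1) \<le> G x powr (real K + 1)"
      using x c C by (intro powr_mono2) auto
    also have "(c / C * (1 / x)) powr (real K + 1) = k * (1 / x) powr (real K + 1)"
      unfolding k_def by (rule powr_mult)
    also have "(1 / x) powr (real K + 1) = (1 / x) ^ Suc K"
      using x powr_realpow[of "1 / x" "Suc K"] by (simp add: add.commute)
    finally have "x ^ m * (k * (1 / x) ^ Suc K) \<le> x ^ m * G x powr (real K + 1)"
      using x by (intro mult_left_mono) auto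
    moreover have "k * (1 / x) \<le> x ^ m * (k * (1 / x) ^ Suc K)"
    proof -
      have "x ^ K \<le> x ^ m" using x a mK by (intro power_decreasing) auto
      then have "x ^ K * (k * (1 / x) ^ Suc K) \<le> x ^ m * (k * (1 / x) ^ Suc K)"
        using x k by (intro mult_right_mono) auto
      moreover have "x ^ K * (k * (1 / x) ^ Suc K) = k * (1 / x)"
        using x by (simp add: power_divide field_simps)
      ultimately show ?thesis by (simp only:)
    qed
    ultimately show ?thesis by linarith
  qed
  have "ennreal k * (\<integral>\<^sup>+x. indicator {0<..<a} x * ennreal (1 / x) \<partial>lborel)
      = (\<integral>\<^sup>+x. ennreal k * (indicator {0<..<a} x * ennreal (1 / x)) \<partial>lborel)"
    by (rule nn_integral_cmult[symmetric]) measurable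
  also have "\<dots> \<le> (\<integral>\<^sup>+x. indicator {0<..} x * ennreal (x ^ m) * ennreal (indicator {0<..<\<delta>} x * G x powr (real K + 1)) \<partial>lborel)"
  proof (rule nn_integral_mono)
    fix x :: real
    show "ennreal k * (indicator {0<..<a} x * ennreal (1 / x))
       \<le> indicator {0<..} x * ennreal (x ^ m) * ennreal (indicator {0<..<\<delta>} x * G x powr (real K + 1))"
    proof (cases "0 < x \<and> x < a")
      case True
      then have "ennreal (k * (1 / x)) \<le> ennreal (x ^ m * G x powr (real K + 1))"
        using key by (intro ennreal_leI) auto
      then show ?thesis using True a k by (simp add: ennreal_mult[symmetric])
    qed auto
  qed
  finally show False using fin k by (simp add: nn_integral_inverse_at_0[OF a(1)] ennreal_mult_top)
qed

lemma infinite_of_AE_lborel: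
  assumes "AE s in (lborel :: real measure). Pr s"
  shows "infinite {s. Pr s}"
proof
  assume "finite {s. Pr s}"
  then have "AE s in lborel. s \<notin> {s. Pr s}"
    by (intro AE_not_in finite_imp_null_set_lborel)
  with assms have "AE s in (lborel :: real measure). False" by eventually_elim simp
  then have "emeasure lborel (UNIV :: real set) = 0"
    by (subst (asm) AE_iff_measurable[of UNIV]) auto
  then show False by simp
qed

section \<open>The three ideals\<close>

lemma eval2_pCons: "eval2 (pCons a P) x y = poly a x + y * eval2 P x y"
  by (simp add: eval2_def map_poly_pCons)

lemma continuous_on_eval2 [continuous_intros]:
  assumes "continuous_on A f" "continuous_on A g"
  shows "continuous_on A (\<lambda>z. eval2 P (f z) (g z))"
proof (induction P)
  case 0 then show ?case by (simp add: eval2_def)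
next
  case (pCons a P)
  then show ?case using assms by (auto simp: eval2_pCons intro!: continuous_intros)
qed

text \<open>For real arguments y + c and x^n are the real and imaginary part of the factor. The
  first two bounds place both generators of an ideal below the factor, the third places the factor
  below the weight.\<close>

lemma bracket_factor_bounds:
  fixes x y c :: real
  shows "\<bar>y + c\<bar> \<le> norm (complex_of_real y + of_real c + \<i> * of_real x ^ n)"
    and "\<bar>x\<bar> ^ n \<le> norm (complex_of_real y + of_real c + \<i> * of_real x ^ n)"
    and "norm (complex_of_real y + of_real c + \<i> * of_real x ^ n) \<le> \<bar>y + c\<bar> + \<bar>x\<bar> ^ n"
proof -
  define z where "z = complex_of_real y + of_real c + \<i> * of_real x ^ n"
  have z: "Re z = y + c" "Im z = x ^ n"
    unfolding z_def of_real_power[symmetric] by simp_all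
  show "\<bar>y + c\<bar> \<le> norm (complex_of_real y + of_real c + \<i> * of_real x ^ n)"
    "\<bar>x\<bar> ^ n \<le> norm (complex_of_real y + of_real c + \<i> * of_real x ^ n)"
    "norm (complex_of_real y + of_real c + \<i> * of_real x ^ n) \<le> \<bar>y + c\<bar> + \<bar>x\<bar> ^ n"
    using abs_Re_le_cmod[of z] abs_Im_le_cmod[of z] cmod_le[of z] unfolding z z_def[symmetric]
    by (simp_all add: power_abs)
qed

text \<open>Restricted to the vicinity of the origin, where the series converges to a continuous
  function. Zeros of P do no harm, as division by zero yields 0 and quotients of Borel functions
  remain Borel.\<close>

lemma quot_real_measurable:
  assumes "conv_ps Q"
  shows "\<exists>r>0. \<forall>U. open U \<longrightarrow> U \<subseteq> ball 0 r \<longrightarrow> set_borel_measurable lborel U (quot_real Q P)"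
proof -
  obtain r where r: "r > 0" and cont: "continuous_on (cball 0 r \<times> cball 0 r) (\<lambda>z. ps_eval Q (fst z) (snd z))"
    using continuous_on_ps_eval[OF assms] by blast
  have "set_borel_measurable lborel U (quot_real Q P)" if U: "open U" "U \<subseteq> ball 0 r" for U
  proof -
    have "norm (fst z) \<le> r \<and> norm (snd z) \<le> r" if "z \<in> U" for z :: "real \<times> real"
    proof -
      have "norm z < r" using U that by auto
      then show ?thesis using norm_fst_le[of "fst z" "snd z"] norm_snd_le[of "snd z" "fst z"] by simp
    qed
    then have "continuous_on U (\<lambda>z. (\<lambda>z. ps_eval Q (fst z) (snd z)) (complex_of_real (fst z), complex_of_real (snd z)))"
      by (intro continuous_on_compose2[OF cont] continuous_intros) auto
    then have "(\<lambda>z. indicator U z *\<^sub>R ps_eval Q (of_real (fst z)) (of_real (snd z))) \<in> borel_measurable borel"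
      using U(1) by (intro borel_measurable_continuous_on_indicator) auto
    moreover have "(\<lambda>z. eval2 P (of_real (fst z)) (of_real (snd z))) \<in> borel_measurable (borel :: (real \<times> real) measure)"
      by (intro borel_measurable_continuous_onI continuous_intros)
    ultimately have "(\<lambda>z. (indicator U z *\<^sub>R ps_eval Q (of_real (fst z)) (of_real (snd z))) /
        eval2 P (of_real (fst z)) (of_real (snd z))) \<in> borel_measurable borel"
      by (rule borel_measurable_divide)
    then show ?thesis
      by (simp add: set_borel_measurable_def quot_real_def case_prod_unfold scaleR_conv_of_real)
  qed
  then show ?thesis using r by blast
qed

lemma I_inf_subset_I_p:
  assumes "p \<ge> 0"
  shows "I_inf P \<subseteq> I_p p P"
proof
  fix Q assume "Q \<in> I_inf P"
  then obtain U C where Q: "conv_ps Q" and U: "open U" "(0,0) \<in> U"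
    and meas: "set_borel_measurable lborel U (quot_real Q P)"
    and bd: "AE z in lborel. z \<in> U \<longrightarrow> norm (quot_real Q P z) \<le> C"
    unfolding I_inf_def Linf_loc_def by blast
  \<comment> \<open>Intersecting with the unit ball makes the measure finite; g extends the quotient
    by zero, since it is known to be measurable only on U.\<close>
  define V where "V = U \<inter> ball 0 1"
  define g where "g z = indicator U z *\<^sub>R quot_real Q P z" for z
  have g [measurable]: "g \<in> borel_measurable borel" using meas by (simp add: g_def[abs_def] set_borel_measurable_def)
  have V: "open V" "(0,0) \<in> V" using U by (auto simp: V_def zero_prod_def[symmetric])
  then have [measurable]: "V \<in> sets borel" by auto
  have geq: "indicator V z *\<^sub>R g z = indicator V z *\<^sub>R quot_real Q P z" for z
    by (auto simp: V_def g_def split: split_indicator)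
  have "set_borel_measurable lborel V (quot_real Q P)"
    unfolding set_borel_measurable_def geq[symmetric] by measurable
  moreover have "set_integrable lborel V (\<lambda>z. norm (quot_real Q P z) powr p)"
  proof -
    have "integrable lborel (\<lambda>z. indicator V z *\<^sub>R (norm (g z) powr p))"
    proof (rule integrableI_bounded_set_indicator)
      show "(\<lambda>z. norm (g z) powr p) \<in> borel_measurable lborel" by measurable
      have "emeasure lborel V \<le> emeasure lborel (ball (0 :: real \<times> real) 1)"
        by (rule emeasure_mono) (auto simp: V_def)
      also have "\<dots> < \<infinity>" by (rule emeasure_lborel_ball_finite)
      finally show "emeasure lborel V < \<infinity>" .
      show "AE z in lborel. z \<in> V \<longrightarrow> norm (norm (g z) powr p) \<le> C powr p"
        using bd
      proof eventually_elim
        case (elim z)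
        then show ?case using assms by (auto simp: V_def g_def intro!: powr_mono2)
      qed
    qed auto
    also have "(\<lambda>z. indicator V z *\<^sub>R (norm (g z) powr p)) = (\<lambda>z. indicator V z *\<^sub>R (norm (quot_real Q P z) powr p))"
      by (auto simp: fun_eq_iff V_def g_def split: split_indicator)
    finally show ?thesis by (simp add: set_integrable_def)
  qed
  ultimately show "Q \<in> I_p p P" unfolding I_p_def Lp_loc_def using Q V by blast
qed

definition bracket_equiv :: "complex poly poly \<Rightarrow> nat \<Rightarrow> (nat \<Rightarrow> real poly) \<Rightarrow> (nat \<Rightarrow> nat) \<Rightarrow> bool" where
  "bracket_equiv P M q m \<longleftrightarrow> (\<exists>e>0. \<exists>C. \<forall>x y::real. 0 < norm (x, y) \<and> norm (x, y) < e \<longrightarrow>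
     (let Pv = eval2 P (of_real x) (of_real y);
          Bv = (\<Prod>j<M. of_real y + of_real (poly (q j) x) + \<i> * of_real x ^ m j)
      in Pv \<noteq> 0 \<and> Bv \<noteq> 0 \<and> norm (Pv / Bv) \<le> C \<and> norm (Bv / Pv) \<le> C))"

lemma bracket_equiv_bounds:
  assumes "bracket_equiv P M q m"
  shows "\<exists>e>0. \<exists>C>0. \<forall>x y. 0 < norm (x, y) \<and> norm (x, y) < e \<longrightarrow>
    eval2 P (of_real x) (of_real y) \<noteq> 0 \<and>
    norm (eval2 P (of_real x) (of_real y))
      \<le> C * norm (\<Prod>j<M. complex_of_real y + of_real (poly (q j) x) + \<i> * of_real x ^ m j) \<and>
    norm (\<Prod>j<M. complex_of_real y + of_real (poly (q j) x) + \<i> * of_real x ^ m j)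
      \<le> C * norm (eval2 P (of_real x) (of_real y))"
proof -
  obtain e C where e: "e > 0" and *: "\<And>x y. 0 < norm (x, y) \<Longrightarrow> norm (x, y) < e \<Longrightarrow>
      eval2 P (of_real x) (of_real y) \<noteq> 0 \<and>
      (\<Prod>j<M. complex_of_real y + of_real (poly (q j) x) + \<i> * of_real x ^ m j) \<noteq> 0 \<and>
      norm (eval2 P (of_real x) (of_real y) / (\<Prod>j<M. complex_of_real y + of_real (poly (q j) x) + \<i> * of_real x ^ m j)) \<le> C \<and>
      norm ((\<Prod>j<M. complex_of_real y + of_real (poly (q j) x) + \<i> * of_real x ^ m j) / eval2 P (of_real x) (of_real y)) \<le> C"
    using assms unfolding bracket_equiv_def Let_def by blast
  \<comment> \<open>The given C comes without a sign; \<open>max C 1\<close> is a positive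
    replacement.\<close>
  have aux: "norm a \<le> max C 1 * norm b" if "norm (a / b) \<le> C" "b \<noteq> 0" for a b :: complex
  proof -
    have "norm a = norm (a / b) * norm b" using that(2) by (simp add: norm_divide)
    also have "\<dots> \<le> max C 1 * norm b" using that(1) by (intro mult_right_mono) auto
    finally show ?thesis .
  qed
  have "max C 1 > 0" by simp
  moreover have "\<forall>x y. 0 < norm (x, y) \<and> norm (x, y) < e \<longrightarrow>
    eval2 P (of_real x) (of_real y) \<noteq> 0 \<and>
    norm (eval2 P (of_real x) (of_real y))
      \<le> max C 1 * norm (\<Prod>j<M. complex_of_real y + of_real (poly (q j) x) + \<i> * of_real x ^ m j) \<and>
    norm (\<Prod>j<M. complex_of_real y + of_real (poly (q j) x) + \<i> * of_real x ^ m j)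
      \<le> max C 1 * norm (eval2 P (of_real x) (of_real y))"
    using * by (blast intro: aux)
  ultimately show ?thesis using e by blast
qed

text \<open>Factor by factor, each generator is dominated by [P] and hence by a multiple of P;
  combinations with locally bounded coefficients inherit this.\<close>

lemma prod_ideal_subset_I_inf:
  assumes be: "bracket_equiv P M q m" and zero: "eval2 P 0 0 = 0"
  shows "prod_ideal M (\<lambda>j x y. y + poly (map_poly of_real (q j)) x) (\<lambda>j x y. x ^ m j) \<subseteq> I_inf P"
proof
  fix Q assume "Q \<in> prod_ideal M (\<lambda>j x y. y + poly (map_poly of_real (q j)) x) (\<lambda>j x y. x ^ m j)"
  then obtain h \<epsilon> where Q: "conv_ps Q" and h: "\<And>S. conv_ps (h S)" and \<epsilon>: "\<epsilon> > 0"
    and eq: "\<And>x y. norm x < \<epsilon> \<and> norm y < \<epsilon> \<Longrightarrow> ps_eval Q x y = (\<Sum>S\<in>Pow {..<M}. ps_eval (h S) x y *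
          (\<Prod>j<M. if j \<in> S then y + poly (map_poly of_real (q j)) x else x ^ m j))"
    unfolding prod_ideal_def by blast
  obtain e C where e: "e > 0" "C > 0"
    and nz: "\<And>x y. 0 < norm (x, y) \<Longrightarrow> norm (x, y) < e \<Longrightarrow> eval2 P (of_real x) (of_real y) \<noteq> 0"
    and PB: "\<And>x y. 0 < norm (x, y) \<Longrightarrow> norm (x, y) < e \<Longrightarrow>
       norm (\<Prod>j<M. complex_of_real y + of_real (poly (q j) x) + \<i> * of_real x ^ m j)
         \<le> C * norm (eval2 P (of_real x) (of_real y))"
    using bracket_equiv_bounds[OF be] by blast
  have "\<forall>S. \<exists>B\<ge>0. \<forall>\<^sub>F z in nhds 0. norm (ps_eval (h S) (fst z) (snd z)) \<le> B"
    using germ2_bounded[OF ps_eval_germ2[OF h]] by blast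
  then obtain B where B: "\<And>S. B S \<ge> 0" "\<And>S. \<forall>\<^sub>F z in nhds 0. norm (ps_eval (h S) (fst z) (snd z)) \<le> B S"
    by metis
  have "\<forall>\<^sub>F z in nhds 0. \<forall>S\<in>Pow {..<M}. norm (ps_eval (h S) (fst z) (snd z)) \<le> B S"
    using B(2) by (intro eventually_ball_finite) auto
  then obtain d where d: "d > 0" "\<And>x y S. norm x < d \<Longrightarrow> norm y < d \<Longrightarrow> S \<subseteq> {..<M} \<Longrightarrow> norm (ps_eval (h S) x y) \<le> B S"
    unfolding eventually_nhds_polydisc by auto
  obtain r where r: "r > 0" "\<And>U. open U \<Longrightarrow> U \<subseteq> ball 0 r \<Longrightarrow> set_borel_measurable lborel U (quot_real Q P)"
    using quot_real_measurable[OF Q] by blast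
  define \<rho> where "\<rho> = Min {r, d, e, \<epsilon>}"
  have \<rho>: "\<rho> > 0" "\<rho> \<le> r" "\<rho> \<le> d" "\<rho> \<le> e" "\<rho> \<le> \<epsilon>" using r d e \<epsilon> by (auto simp: \<rho>_def)
  define D where "D = (\<Sum>S\<in>Pow {..<M}. B S) * C"
  have D: "D \<ge> 0" unfolding D_def using B(1) e(2) by (intro mult_nonneg_nonneg sum_nonneg) auto
  have "norm (quot_real Q P (x, y)) \<le> D" if xy: "norm (x, y) < \<rho>" for x y
  proof (cases "(x, y) = (0, 0)")
    case True
    \<comment> \<open>P vanishes at the origin, so the quotient there is 0 by the convention for
      division by zero.\<close>
    then show ?thesis using zero D by (simp add: quot_real_def)
  next
    case False
    then have pos: "0 < norm (x, y)" by (simp add: zero_prod_def)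
    have sm: "norm (complex_of_real x) < \<rho>" "norm (complex_of_real y) < \<rho>"
      using norm_fst_le[of x y] norm_snd_le[of y x] xy by auto
    define W where "W = norm (\<Prod>j<M. complex_of_real y + of_real (poly (q j) x) + \<i> * of_real x ^ m j)"
    have g: "norm (\<Prod>j<M. if j \<in> S then complex_of_real y + poly (map_poly of_real (q j)) (of_real x) else of_real x ^ m j) \<le> W" for S
      unfolding W_def prod_norm[symmetric]
    proof (intro prod_mono conjI)
      fix j
      have "norm (complex_of_real y + poly (map_poly of_real (q j)) (of_real x)) = \<bar>y + poly (q j) x\<bar>"
        unfolding poly_map_poly_of_real of_real_add[symmetric] norm_of_real ..
      then show "norm (if j \<in> S then complex_of_real y + poly (map_poly of_real (q j)) (of_real x) else of_real x ^ m j)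
          \<le> norm (complex_of_real y + of_real (poly (q j) x) + \<i> * of_real x ^ m j)"
        using bracket_factor_bounds(1,2)[where y = y and c = "poly (q j) x" and x = x and n = "m j"] by (auto simp: norm_power)
    qed auto
    have "norm (ps_eval Q (of_real x) (of_real y)) \<le> (\<Sum>S\<in>Pow {..<M}. B S * W)"
      using sm \<rho> d(2) g B(1)
      by (subst eq) (auto simp: norm_mult intro!: sum_norm_le mult_mono)
    also have "\<dots> = (\<Sum>S\<in>Pow {..<M}. B S) * W" by (simp add: sum_distrib_right)
    also have "\<dots> \<le> (\<Sum>S\<in>Pow {..<M}. B S) * (C * norm (eval2 P (of_real x) (of_real y)))"
      using PB[OF pos] xy \<rho> B(1) unfolding W_def by (intro mult_left_mono sum_nonneg) auto
    finally show ?thesis using nz[OF pos] xy \<rho>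
      by (simp add: quot_real_def D_def norm_divide divide_le_eq mult_ac)
  qed
  then have "\<forall>z. z \<in> ball 0 \<rho> \<longrightarrow> norm (quot_real Q P z) \<le> D" by auto
  then have "AE z in lborel. z \<in> ball 0 \<rho> \<longrightarrow> norm (quot_real Q P z) \<le> D" by (rule always_eventually)
  moreover have "set_borel_measurable lborel (ball 0 \<rho>) (quot_real Q P)" using \<rho> by (intro r(2) open_ball subset_ball)
  moreover have "(0, 0) \<in> ball (0 :: real \<times> real) \<rho>" using \<rho> by (simp add: zero_prod_def[symmetric])
  ultimately show "Q \<in> I_inf P" unfolding I_inf_def Linf_loc_def using Q open_ball by blast
qed

text \<open>Only finitely many subsets occur in the sum, so one polydisc serves the expansions of
  all coefficients.\<close>

lemma in_ideal_imp_prod_ideal: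
  assumes Q: "conv_ps Q" and "in_ideal q m {..<M} (\<lambda>z. ps_eval Q (fst z) (snd z))"
  shows "Q \<in> prod_ideal M (\<lambda>j x y. y + poly (map_poly of_real (q j)) x) (\<lambda>j x y. x ^ m j)"
proof -
  obtain h where h: "\<And>S. germ2 (h S)" and eq: "\<forall>\<^sub>F z in nhds 0. ps_eval Q (fst z) (snd z) = (\<Sum>S\<in>Pow {..<M}. h S z * ideal_gen q m {..<M} S z)"
    using assms(2) unfolding in_ideal_def by blast
  have "\<forall>S. \<exists>c. conv_ps c \<and> (\<forall>\<^sub>F z in nhds 0. h S z = ps_eval c (fst z) (snd z))"
    using h germ2_iff_ps_eval by blast
  then obtain c where c: "\<And>S. conv_ps (c S)" "\<And>S. \<forall>\<^sub>F z in nhds 0. h S z = ps_eval (c S) (fst z) (snd z)" by metis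
  have "\<forall>\<^sub>F z in nhds 0. \<forall>S\<in>Pow {..<M}. h S z = ps_eval (c S) (fst z) (snd z)"
    using c(2) by (intro eventually_ball_finite) auto
  with eq have "\<forall>\<^sub>F z in nhds 0. ps_eval Q (fst z) (snd z) =
      (\<Sum>S\<in>Pow {..<M}. ps_eval (c S) (fst z) (snd z) * ideal_gen q m {..<M} S z)"
    by eventually_elim (auto intro!: sum.cong)
  then show ?thesis unfolding eventually_nhds_polydisc prod_ideal_def ideal_gen_def fst_conv snd_conv
    using Q c(1) by blast
qed

text \<open>The analytic half. The weights bound P from above on the curve, so too small an order of
  Q there would make the integral of the quotient diverge. The proof obtains almost every s; the
  conclusion keeps what the algebraic half asks for.\<close>

lemma I_p_curve_bound:
  assumes be: "bracket_equiv P M q m"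
    and q0: "poly (q j) 0 = 0" and mj: "0 < m j" "m j \<le> K"
    and QI: "Q \<in> I_p (real K + 1) P"
  shows "infinite {s. curve_bound q m {..<M} (\<lambda>z. ps_eval Q (fst z) (snd z)) j s}"
proof -
  obtain U where Q: "conv_ps Q" and U: "open U" "(0,0) \<in> U"
    and int: "set_integrable lborel U (\<lambda>z. norm (quot_real Q P z) powr (real K + 1))"
    using QI unfolding I_p_def Lp_loc_def by blast
  obtain e C where e: "e > 0" "C > 0"
    and nz: "\<And>x y. 0 < norm (x, y) \<Longrightarrow> norm (x, y) < e \<Longrightarrow> eval2 P (of_real x) (of_real y) \<noteq> 0"
    and PB: "\<And>x y. 0 < norm (x, y) \<Longrightarrow> norm (x, y) < e \<Longrightarrow> norm (eval2 P (of_real x) (of_real y)) \<le>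
       C * norm (\<Prod>j<M. complex_of_real y + of_real (poly (q j) x) + \<i> * of_real x ^ m j)"
    using bracket_equiv_bounds[OF be] by blast
  define H where "H z = ennreal (indicator U z * norm (quot_real Q P z) powr (real K + 1))" for z
  have int': "integrable lborel (\<lambda>z. indicator U z * norm (quot_real Q P z) powr (real K + 1))"
    using int by (simp add: set_integrable_def)
  then have "(\<integral>\<^sup>+z. ennreal (norm (indicator U z * norm (quot_real Q P z) powr (real K + 1))) \<partial>lborel) < \<infinity>"
    unfolding integrable_iff_bounded by blast
  then have Hfin: "(\<integral>\<^sup>+z. H z \<partial>lborel) < \<infinity>" by (simp add: H_def)
  have Hmeas: "H \<in> borel_measurable borel"
    using borel_measurable_integrable[OF int'] unfolding H_def[abs_def] by simp
  have "(\<lambda>x. - poly (q j) x) \<in> borel_measurable borel"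
    by (intro borel_measurable_continuous_onI continuous_intros)
  from AE_nn_integral_curve_finite[OF Hmeas this Hfin, of "m j"]
  have "AE s in lborel. curve_bound q m {..<M} (\<lambda>z. ps_eval Q (fst z) (snd z)) j s"
  proof eventually_elim
    case (elim s)
    define g where "g x = s * x ^ m j - poly (q j) x" for x
    define W where "W x = (\<Prod>k<M. \<bar>g x + poly (q k) x\<bar> + x ^ m k)" for x
    \<comment> \<open>The integral criterion compares with a pure power, so the weights are replaced
      by x to their exact order on this curve; the two-sided estimate allows the return to the
      weights at the end.\<close>
    obtain v where v: "W \<in> \<Theta>[at_right 0](\<lambda>x. x ^ v)"
    proof -
      have "\<forall>k. \<exists>a. (\<lambda>x. \<bar>poly (q k - q j + monom s (m j)) x\<bar> + x ^ m k) \<in> \<Theta>[at_right 0](\<lambda>x. x ^ a)"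
        using weight_bigtheta by blast
      then obtain a where "\<And>k. (\<lambda>x. \<bar>poly (q k - q j + monom s (m j)) x\<bar> + x ^ m k) \<in> \<Theta>[at_right 0](\<lambda>x. x ^ a k)"
        by metis
      moreover have "poly (q k - q j + monom s (m j)) x = g x + poly (q k) x" for k x
        by (simp add: g_def poly_monom)
      ultimately have "(\<lambda>x. \<bar>g x + poly (q k) x\<bar> + x ^ m k) \<in> \<Theta>[at_right 0](\<lambda>x. x ^ a k)" for k
        by (simp only:)
      then have "(\<lambda>x. W x) \<in> \<Theta>[at_right 0](\<lambda>x. x ^ (\<Sum>k<M. a k))"
        unfolding W_def by (intro prod_bigtheta_power)
      then show ?thesis using that by blast
    qed
    obtain C1 where C1: "C1 > 0" "\<forall>\<^sub>F x in at_right 0. norm (W x) \<le> C1 * norm (x ^ v)"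
      using landau_o.bigE[OF bigthetaD1[OF v]] by blast
    \<comment> \<open>The complexification of g, which makes Q along the curve a holomorphic
      function of one variable.\<close>
    define \<gamma> where "\<gamma> z = of_real s * z ^ m j - poly (map_poly of_real (q j)) z" for z :: complex
    have \<gamma>r: "\<gamma> (of_real x) = of_real (g x)" for x
      unfolding \<gamma>_def poly_map_poly_of_real by (simp add: g_def)
    have "\<gamma> 0 = 0" using \<gamma>r[of 0] mj(1) q0 by (simp add: g_def power_0_left)
    moreover have "\<gamma> holomorphic_on ball 0 1" unfolding \<gamma>_def by (intro holomorphic_intros)
    ultimately obtain d where d: "d > 0" "(\<lambda>z. ps_eval Q z (\<gamma> z)) holomorphic_on ball 0 d"
      using germ2_curve_holomorphic[OF ps_eval_germ2[OF Q], of \<gamma> 1] by auto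
    have g0: "(g \<longlongrightarrow> 0) (at_right 0)" using curve_tendsto_0[OF mj(1) q0, of s] by (simp add: g_def[abs_def])
    have "((\<lambda>x. (x, g x)) \<longlongrightarrow> (0, 0)) (at_right 0)"
      by (intro tendsto_intros g0)
    moreover have "open (U \<inter> ball 0 e)" "(0,0) \<in> U \<inter> ball 0 e"
      using U e by (auto simp: zero_prod_def[symmetric])
    ultimately have "\<forall>\<^sub>F x in at_right 0. (x, g x) \<in> U \<inter> ball 0 e" by (rule topological_tendstoD)
    with C1(2) have "\<forall>\<^sub>F x in at_right 0. (x, g x) \<in> U \<inter> ball 0 e \<and> norm (W x) \<le> C1 * norm (x ^ v)"
      by eventually_elim simp
    then obtain \<delta> where \<delta>: "\<delta> > 0" "\<And>x. 0 < x \<Longrightarrow> x < \<delta> \<Longrightarrow> (x, g x) \<in> U \<inter> ball 0 e \<and> norm (W x) \<le> C1 * norm (x ^ v)"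
      unfolding eventually_at_right_field by auto
    have "(\<lambda>x. norm (ps_eval Q (complex_of_real x) (\<gamma> (of_real x)))) \<in> O[at_right 0](\<lambda>x. x ^ v)"
    proof (rule bigo_of_nn_integral_finite[OF d(2,1) mj(2) _ \<delta>(1)])
      \<comment> \<open>C compares P with its bracket, and C1 compares the weights with x^v.\<close>
      show "0 < C * C1" using e C1 by simp
      fix x :: real assume x: "0 < x" "x < \<delta>"
      have nrm: "0 < norm (x, g x)" "norm (x, g x) < e"
        using x \<delta>(2)[OF x] by (simp add: zero_prod_def, simp)
      have "norm (\<Prod>k<M. complex_of_real (g x) + of_real (poly (q k) x) + \<i> * of_real x ^ m k) \<le> W x"
        unfolding W_def prod_norm[symmetric]
      proof (intro prod_mono conjI)
        show "norm (complex_of_real (g x) + of_real (poly (q k) x) + \<i> * of_real x ^ m k) \<le> \<bar>g x + poly (q k) x\<bar> + x ^ m k" for k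
          using bracket_factor_bounds(3)[where y = "g x" and c = "poly (q k) x" and x = x and n = "m k"] x by simp
      qed auto
      also have "W x \<le> C1 * x ^ v" using \<delta>(2)[OF x] x by auto
      finally have "norm (eval2 P (of_real x) (of_real (g x))) \<le> C * (C1 * x ^ v)"
        using PB[OF nrm] e(2) by (meson mult_left_mono less_imp_le order_trans)
      then show "norm (ps_eval Q (complex_of_real x) (\<gamma> (of_real x))) / (C * C1 * x ^ v) \<le> norm (quot_real Q P (x, g x))"
        using nz[OF nrm] x e C1 by (auto simp: quot_real_def norm_divide \<gamma>r mult_ac intro!: divide_left_mono)
    next
      have "(\<integral>\<^sup>+x. indicator {0<..} x * ennreal (x ^ m j) *
            ennreal (indicator {0<..<\<delta>} x * norm (quot_real Q P (x, g x)) powr (real K + 1)) \<partial>lborel)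
          \<le> (\<integral>\<^sup>+x. indicator {0<..} x * ennreal (x ^ m j) * H (x, - poly (q j) x + s * x ^ m j) \<partial>lborel)"
      proof (intro nn_integral_mono mult_left_mono)
        fix x :: real
        have "- poly (q j) x + s * x ^ m j = g x" by (simp add: g_def)
        moreover have "indicat_real {0<..<\<delta>} x \<le> indicator U (x, g x)"
          using \<delta>(2)[of x] by (auto split: split_indicator)
        ultimately show "ennreal (indicator {0<..<\<delta>} x * norm (quot_real Q P (x, g x)) powr (real K + 1))
            \<le> H (x, - poly (q j) x + s * x ^ m j)"
          by (auto simp: H_def intro!: ennreal_leI mult_right_mono)
      qed auto
      then show "(\<integral>\<^sup>+x. indicator {0<..} x * ennreal (x ^ m j) *
            ennreal (indicator {0<..<\<delta>} x * norm (quot_real Q P (x, g x)) powr (real K + 1)) \<partial>lborel) < \<infinity>"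
        using elim by (rule order_le_less_trans)
    qed
    also have "(\<lambda>x. x ^ v) \<in> O[at_right 0](W)" using v by (simp add: bigtheta_def bigomega_iff_bigo)
    finally show ?case by (simp add: curve_bound_def W_def[abs_def] g_def \<gamma>r)
  qed
  then show ?thesis by (rule infinite_of_AE_lborel)
qed

theorem theorem5p6:
  fixes P :: "complex poly poly" and M :: nat
    and L :: "nat \<Rightarrow> nat" and q :: "nat \<Rightarrow> real poly"
  assumes no_zeros: "\<forall>x y. Im x > 0 \<and> Im y > 0 \<longrightarrow> eval2 P x y \<noteq> 0"
    and zero: "eval2 P 0 0 = 0"
    and coprime: "\<forall>D. D dvd P \<and> D dvd conj2 P \<longrightarrow> is_unit D"
    and order: "M = vanishing_order P"
    and q0: "\<forall>j<M. poly (q j) 0 = 0"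
    and q1: "\<forall>j<M. poly (pderiv (q j)) 0 > 0"
    and qdeg: "\<forall>j<M. degree (q j) < 2 * L j"
    and bracket: "\<exists>e>0. \<exists>C. \<forall>x y::real. 0 < norm (x, y) \<and> norm (x, y) < e \<longrightarrow>
        (let Pv = eval2 P (of_real x) (of_real y);
             Bv = (\<Prod>j<M. of_real y + of_real (poly (q j) x) + \<i> * of_real x ^ (2 * L j))
         in Pv \<noteq> 0 \<and> Bv \<noteq> 0 \<and> norm (Pv / Bv) \<le> C \<and> norm (Bv / Pv) \<le> C)"
  defines "K \<equiv> Max {2 * L j | j. j < M}"
  shows "I_p (real K + 1) P \<subseteq>
           prod_ideal M (\<lambda>j x y. y + poly (map_poly of_real (q j)) x) (\<lambda>j x y. x ^ (2 * L j))
       \<and> prod_ideal M (\<lambda>j x y. y + poly (map_poly of_real (q j)) x) (\<lambda>j x y. x ^ (2 * L j))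
           = I_p (real K + 1) P
       \<and> I_p (real K + 1) P = I_inf P"
proof -
  define m where "m j = 2 * L j" for j
  have be: "bracket_equiv P M q m" unfolding bracket_equiv_def m_def by (rule bracket)
  have mK: "m j \<le> K" if "j < M" for j
  proof -
    have "finite {2 * L j |j. j < M}" by simp
    then show ?thesis unfolding K_def m_def by (rule Max_ge) (use that in blast)
  qed
  have sub: "I_p (real K + 1) P \<subseteq> prod_ideal M (\<lambda>j x y. y + poly (map_poly of_real (q j)) x) (\<lambda>j x y. x ^ m j)"
  proof
    fix Q assume Q: "Q \<in> I_p (real K + 1) P"
    then have conv: "conv_ps Q" by (simp add: I_p_def)
    \<comment> \<open>The strict degree bound rules out \<open>L j = 0\<close>.\<close>
    have mpos: "0 < m j" if "j < M" for j using qdeg that by (auto simp: m_def)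
    have "in_ideal q m {..<M} (\<lambda>z. ps_eval Q (fst z) (snd z))"
      using q0 mpos mK Q be
      by (intro curve_bound_imp_in_ideal ps_eval_germ2[OF conv] I_p_curve_bound) auto
    then show "Q \<in> prod_ideal M (\<lambda>j x y. y + poly (map_poly of_real (q j)) x) (\<lambda>j x y. x ^ m j)"
      by (rule in_ideal_imp_prod_ideal[OF conv])
  qed
  moreover have "prod_ideal M (\<lambda>j x y. y + poly (map_poly of_real (q j)) x) (\<lambda>j x y. x ^ m j) \<subseteq> I_inf P"
    by (rule prod_ideal_subset_I_inf[OF be zero])
  moreover have "I_inf P \<subseteq> I_p (real K + 1) P" by (rule I_inf_subset_I_p) simp
  ultimately show ?thesis unfolding m_def by blast
qed

end
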